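(* Let $\theta_a,\theta_d>0$, let $n,N$ be positive integers, $E=\mathbb{R}^N$, and let $\eta$ be a Borel probability measure on $E$ supported on $\{\mathbf{x}\in E:|\mathbf{x}|_\infty\le R\}$ for some $R>0$, with mean $\overline{\eta}=\int_E\mathbf{x}\,d\eta(\mathbf{x})$. Let $\rho$ be a Borel probability distribution on $\mathsf{X}$ such that $\rho\circ\pi^{-1}=\sigma$, where \[\sigma=\frac{1}{(\theta_d+\theta_a)^n}\sum_{k=0}^{n}\binom{n}{k}\theta_d^{\,n-k}\theta_a^{\,k}\,\delta_k,\] and such that $f_i$ is $\rho$-integrable for every $i\in\{0,\dots,n\}$. Let $X$ be the continuous-time process on $\mathsf{X}$ constructed from $\rho$ as described in the context. Then for every $t>0$, \[\frac{\partial}{\partial t}\mathbb{E}(f_n(X_t))=\frac{\overline{\eta}\,\theta_d}{(\theta_d+\theta_a)^n}\Big((\theta_d+\theta_a)^n-\theta_d^{\,n}\Big).\]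
   Context: Notation: for a positive integer $k$, $[k]=\{0,1,\dots,k-1\}$. Elements of $\{0,1\}^{[n]}$ and $E^{[n+1]}$ are functions; for $\psi\in\{0,1\}^{[n]}$ let $|\psi|=\sum_{i\in[n]}\psi(i)$. The state space is $\mathsf{X}=\{(\psi,\mathbf{v})\in\{0,1\}^{[n]}\times E^{[n+1]}:\sum_{i\in[n]}\psi(i)(\mathbf{v}(i)-\mathbf{v}(n))=0\}$, with the subspace topology of the product topology (discrete on $\{0,1\}$, Euclidean on $E$) and its Borel $\sigma$-algebra. (Interpretation: $n$ objects, $\psi(i)$ = attached(1)/detached(0) status of object $i$, $\mathbf{v}(i)$ its location, $\mathbf{v}(n)$ the centroid of attached objects.) Let $\pi:\mathsf{X}\to\{0,\dots,n\}$, $\pi(\psi,\mathbf{v})=|\psi|$, and $f_i(\psi,\mathbf{v})=\mathbf{v}(i)$ for $i\in[n+1]$. For $i\in[n]$: $r_i(\psi)=\frac{\theta_d\psi(i)+\theta_a(1-\psi(i))}{\theta_d|\psi|+\theta_a(n-|\psi|)}$, and $s_i(\psi)$ agrees with $\psi$ except $s_i(\psi)(i)=1-\psi(i)$. For $\mathsf{x}=(\psi,\mathbf{v})\in\mathsf{X}$ and $i\in[n]$, let $\lambda_i^{\mathsf{x}}$ be the law of the random element $(s_i(\psi),\mathbf{w})$ of $\{0,1\}^{[n]}\times E^{[n+1]}$, where $\mathbf{w}(j)=\mathbf{v}(j)$ for $j\in[n]\setminus\{i\}$ and $(\mathbf{w}(i),\mathbf{w}(n))$ equals: $(\mathbf{v}(i),\mathbf{v}(n))$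 if $|\psi|=\psi(i)=1$; $(\mathbf{v}(i),\mathbf{v}(n)-\frac{\mathbf{v}(i)-\mathbf{v}(n)}{|\psi|-1})$ if $|\psi|>\psi(i)=1$; $(\mathbf{x}+\mathbf{v}(n),\frac{\mathbf{x}}{|\psi|+1}+\mathbf{v}(n))$ with $\mathbf{x}$ an $\eta$-distributed random vector if $\psi(i)=0$. The jump kernel is $\mu(\mathsf{x},B)=\sum_{i\in[n]}r_i(\psi)\lambda_i^{\mathsf{x}}(B)$ for Borel $B\subseteq\mathsf{X}$; the rate function is $c(\psi,\mathbf{v})=\theta_d|\psi|+\theta_a(n-|\psi|)$. Construction of $X$ from $\rho$: let $Y$ be a discrete-time Markov chain on $\mathsf{X}$ with transition kernel $\mu$ and $Y_0\sim\rho$; let $(\gamma_k)_{k\ge1}$ be i.i.d. standard exponential random variables with $\{Y,\gamma_1,\gamma_2,\dots\}$ independent; $\tau_0=0$, $\tau_k=\sum_{i=1}^k\gamma_i/c(Y_{i-1})$; and $X_t=Y_k$ for $t\in[\tau_k,\tau_{k+1})$. *)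

theory Defs
  imports "HOL-Probability.Probability"
begin

text \<open>States: pairs (psi, v) with psi : [n] -> {0,1} (encoded as bool, True = attached)
  and v : [n+1] -> E, E = real^'N.  Functions are extensional (undefined outside their domain),
  as in the finite product measure PiM.\<close>

type_synonym 'N state = "(nat \<Rightarrow> bool) \<times> (nat \<Rightarrow> real^'N)"

definition card_psi :: "nat \<Rightarrow> (nat \<Rightarrow> bool) \<Rightarrow> nat" where
  "card_psi n \<psi> = card {i. i < n \<and> \<psi> i}"

definition Xset :: "nat \<Rightarrow> 'N::finite state set" where
  "Xset n = {(\<psi>, v). \<psi> \<in> extensional {..<n} \<and> v \<in> extensional {..<Suc n} \<and>
              (\<Sum>i<n. of_bool (\<psi> i) *\<^sub>R (v i - v n)) = 0}"

text \<open>Borel sigma algebra of the subspace topology of the product topology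
  (discrete on {0,1}, Euclidean on E); for finite products of second countable spaces this
  is the product sigma algebra restricted to Xset.\<close>
definition stateM :: "nat \<Rightarrow> 'N::finite state measure" where
  "stateM n = restrict_space
     (PiM {..<n} (\<lambda>_. count_space UNIV) \<Otimes>\<^sub>M PiM {..<Suc n} (\<lambda>_. (borel :: (real^'N) measure)))
     (Xset n)"

definition rate_fun :: "real \<Rightarrow> real \<Rightarrow> nat \<Rightarrow> 'N::finite state \<Rightarrow> real" where
  "rate_fun \<theta>a \<theta>d n x = \<theta>d * real (card_psi n (fst x)) + \<theta>a * (real n - real (card_psi n (fst x)))"

definition r_i :: "real \<Rightarrow> real \<Rightarrow> nat \<Rightarrow> nat \<Rightarrow> (nat \<Rightarrow> bool) \<Rightarrow> real" where
  "r_i \<theta>a \<theta>d n i \<psi> =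
     (\<theta>d * of_bool (\<psi> i) + \<theta>a * (1 - of_bool (\<psi> i))) /
     (\<theta>d * real (card_psi n \<psi>) + \<theta>a * (real n - real (card_psi n \<psi>)))"

definition s_i :: "nat \<Rightarrow> (nat \<Rightarrow> bool) \<Rightarrow> (nat \<Rightarrow> bool)" where
  "s_i i \<psi> = \<psi>(i := \<not> \<psi> i)"

definition lam_i :: "(real^'N::finite) measure \<Rightarrow> nat \<Rightarrow> nat \<Rightarrow> 'N state \<Rightarrow> 'N state set \<Rightarrow> real" where
  "lam_i \<eta> n i x B = (let \<psi> = fst x; v = snd x; k = card_psi n \<psi> in
     if \<psi> i then
       (if k = 1 then indicator B (s_i i \<psi>, v)
        else indicator B (s_i i \<psi>, v(n := v n - (1 / (real k - 1)) *\<^sub>R (v i - v n))))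
     else measure \<eta> {y \<in> space \<eta>. (s_i i \<psi>, v(i := y + v n, n := (1 / (real k + 1)) *\<^sub>R y + v n)) \<in> B})"

definition jump_kernel :: "real \<Rightarrow> real \<Rightarrow> (real^'N::finite) measure \<Rightarrow> nat \<Rightarrow> 'N state \<Rightarrow> 'N state set \<Rightarrow> real" where
  "jump_kernel \<theta>a \<theta>d \<eta> n x B = (\<Sum>i<n. r_i \<theta>a \<theta>d n i (fst x) * lam_i \<eta> n i x B)"

definition sigma_w :: "real \<Rightarrow> real \<Rightarrow> nat \<Rightarrow> nat \<Rightarrow> real" where
  "sigma_w \<theta>a \<theta>d n k = (if k \<le> n then
      real (n choose k) * \<theta>d ^ (n - k) * \<theta>a ^ k / (\<theta>d + \<theta>a) ^ n else 0)"

definition jump_time :: "('N::finite state \<Rightarrow> real) \<Rightarrow> (nat \<Rightarrow> 'w \<Rightarrow> 'N state) \<Rightarrow> (nat \<Rightarrow> 'w \<Rightarrow> real) \<Rightarrow> nat \<Rightarrow> 'w \<Rightarrow> real" where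
  "jump_time c Y \<gamma> k \<omega> = (\<Sum>i\<in>{1..k}. \<gamma> i \<omega> / c (Y (i - 1) \<omega>))"

definition Xproc :: "('N::finite state \<Rightarrow> real) \<Rightarrow> (nat \<Rightarrow> 'w \<Rightarrow> 'N state) \<Rightarrow> (nat \<Rightarrow> 'w \<Rightarrow> real) \<Rightarrow> real \<Rightarrow> 'w \<Rightarrow> 'N state" where
  "Xproc c Y \<gamma> t \<omega> = Y (LEAST k. jump_time c Y \<gamma> k \<omega> \<le> t \<and> t < jump_time c Y \<gamma> (Suc k) \<omega>) \<omega>"

end

theory Submission
  imports Defs
begin

text \<open>The generator of the process maps \<open>f\<^sub>n\<close> to \<open>\<theta>a (n - k) / (k + 1)\<close> times the mean of \<open>\<eta>\<close>, where \<open>k\<close> is the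
  number of attached objects: detachments contribute nothing because the centroid condition makes their
  shifts cancel. The number of attached objects is itself a birth-death chain, and \<open>\<sigma>\<close> is reversible for
  it, so the expected drift is constant in time; by detailed balance it equals \<open>\<theta>d (1 - \<sigma> 0)\<close> times the mean.

  To turn this into a statement about the jump construction, condition on the finitely many possible values
  of the number of attached objects along the first jumps. On each such event the jump times are sums of
  independent exponentials, independent of the chain, and their distribution functions satisfy
  \<open>H\<^sub>k\<^sub>+\<^sub>1' = c\<^sub>k (H\<^sub>k - H\<^sub>k\<^sub>+\<^sub>1)\<close> and \<open>H\<^sub>k s \<le> (C s)\<^sup>k / k!\<close>, which beats the growth \<open>3\<^sup>k\<close> of the
  first moments of the chain.\<close>

section \<open>Sums of independent exponential variables\<close>

text \<open>The process at a fixed time is never shown to be Markov. The Markov property is used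
  only for the discrete chain, at the random times \<open>\<tau> (Suc k)\<close>; the obstacle is
  that these depend on the chain as well as on the clocks. But \<open>\<tau> (Suc k)\<close> sees
  the chain only through the counts \<open>J 0, ..., J k\<close>. Fixing these values makes it a
  function of the clocks alone, while the last step to \<open>Y (Suc k)\<close> can still be
  averaged out.

  A fixed time \<open>s\<close> is reached by telescoping: the state at \<open>s\<close> is
  \<open>Y k\<close> for the one \<open>k\<close> with jump \<open>k\<close> made and jump
  \<open>Suc k\<close> still to come. One step of the chain at \<open>\<tau> (Suc k)\<close> changes
  the mean of the centroid by drift divided by rate; everything else cancels except the first term
  and a vanishing remainder. What is left counts departures, and the expected number of departures
  from count \<open>l\<close> by time \<open>s\<close> is \<open>c l * \<sigma> l * s\<close>. So
  the mean of the centroid is affine in \<open>s\<close>, and nothing is differentiated under an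
  expectation.\<close>

text \<open>Gronwall's comparison: the integrating factor \<open>exp (c * u)\<close> turns the
  differential inequality into monotonicity. Derivatives are taken within the half-line because the
  distribution functions below are meaningful only there; \<open>c = 0\<close> gives plain
  monotonicity.\<close>

lemma nonneg_of_deriv_ge:
  fixes g g' :: "real \<Rightarrow> real"
  assumes der: "\<And>s. 0 \<le> s \<Longrightarrow> (g has_real_derivative g' s) (at s within {0..})"
    and ge: "\<And>s. 0 \<le> s \<Longrightarrow> - c * g s \<le> g' s"
    and "0 \<le> g 0" and "0 \<le> s"
  shows "0 \<le> g s"
proof -
  let ?h = "\<lambda>u. exp (c * u) * g u"
  have d: "(?h has_real_derivative exp (c * u) * (c * g u + g' u)) (at u within {0..})" if "0 \<le> u" for u
    by (rule derivative_eq_intros der that refl | simp add: algebra_simps)+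
  have "?h 0 \<le> ?h s"
  proof (rule DERIV_nonneg_imp_increasing_open[where f="?h"])
    show "0 \<le> s" by fact
    show "continuous_on {0..s} ?h"
      by (rule continuous_on_subset[OF DERIV_continuous_on[of "{0..}"]]) (use d in auto)
    fix u assume u: "0 < u" "u < s"
    have "(?h has_real_derivative exp (c * u) * (c * g u + g' u)) (at u)"
      using d[of u] u at_within_interior[of u "{0..}"] by auto
    moreover have "0 \<le> exp (c * u) * (c * g u + g' u)"
      using ge[of u] u by simp
    ultimately show "\<exists>y. (?h has_real_derivative y) (at u) \<and> 0 \<le> y" by blast
  qed
  then show ?thesis using \<open>0 \<le> g 0\<close>
    by (simp add: zero_le_mult_iff order_trans) (smt (verit) exp_gt_zero zero_le_mult_iff)
qed

text \<open>These functions solve the equations of \<open>hypoexp_cdf_deriv\<close> with every rate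
  equal to \<open>C\<close> and the loss term dropped, which is why they can serve as
  majorants.\<close>

lemma has_real_derivative_power_over_fact:
  fixes C :: real
  shows "((\<lambda>s. (C * s) ^ Suc k / fact (Suc k)) has_real_derivative C * ((C * s) ^ k / fact k)) (at s within A)"
proof -
  have "((\<lambda>s. (C * s) ^ Suc k / fact (Suc k)) has_real_derivative
      (1 + real k) * (C * (C * s) ^ k) / fact (Suc k)) (at s within A)"
    by (intro DERIV_cdivide DERIV_power_Suc DERIV_cmult_Id)
  also have "(1 + real k) * (C * (C * s) ^ k) / fact (Suc k)
      = (1 + real k) * (C * (C * s) ^ k) / ((1 + real k) * fact k)" by simp
  also have "\<dots> = C * ((C * s) ^ k / fact k)"
    by (subst mult_divide_mult_cancel_left) auto
  finally show ?thesis .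
qed

lemma power_over_fact_tendsto_0: "(\<lambda>k. (x :: real) ^ k / fact k) \<longlonglongrightarrow> 0"
  using summable_LIMSEQ_zero[OF summable_exp[of x]] by (simp add: field_simps)

text \<open>The distribution function, on \<open>{0..}\<close> only, of a sum of \<open>k\<close> independent exponential variables
  with rates \<open>c 0, \<dots>, c (k - 1)\<close>; the recursion convolves with the density of the last summand.\<close>

fun hypoexp_cdf :: "(nat \<Rightarrow> real) \<Rightarrow> nat \<Rightarrow> real \<Rightarrow> real" where
  "hypoexp_cdf c 0 s = 1"
| "hypoexp_cdf c (Suc k) s =
     c k * exp (- c k * s) * integral {0..s} (\<lambda>u. exp (c k * u) * hypoexp_cdf c k u)"

text \<open>Product rule and fundamental theorem of calculus. Differentiating level
  \<open>Suc k\<close> takes only continuity of level \<open>k\<close>, which is a hypothesis here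
  because its own induction proof runs through this lemma.\<close>

lemma hypoexp_cdf_deriv_aux:
  assumes cont: "continuous_on {0..} (hypoexp_cdf c k)" and "0 \<le> s"
  shows "(hypoexp_cdf c (Suc k) has_real_derivative
           c k * (hypoexp_cdf c k s - hypoexp_cdf c (Suc k) s)) (at s within {0..})"
proof -
  let ?I = "\<lambda>s. integral {0..s} (\<lambda>u. exp (c k * u) * hypoexp_cdf c k u)"
  \<comment> \<open>Near \<open>s\<close> the half-line agrees with the compact interval
    \<open>{0..s+1}\<close>, on which the integral is differentiated; the \<open>+1\<close> keeps
    \<open>s\<close> away from the right end.\<close>
  have *: "at s within {0..} = at s within {0..s+1}"
    by (rule at_within_nhd[of s "{..<s+1}"]) (use \<open>0 \<le> s\<close> in auto)
  have "(?I has_real_derivative exp (c k * s) * hypoexp_cdf c k s) (at s within {0..})"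
    unfolding * using \<open>0 \<le> s\<close>
    by (intro integral_has_real_derivative continuous_intros continuous_on_subset[OF cont]) auto
  then have "((\<lambda>s. c k * exp (- c k * s) * ?I s) has_real_derivative
      c k * (exp (- c k * s) * (exp (c k * s) * hypoexp_cdf c k s)
        - c k * exp (- c k * s) * ?I s)) (at s within {0..})"
    by (auto intro!: derivative_eq_intros simp: algebra_simps)
  also have "exp (- c k * s) * (exp (c k * s) * hypoexp_cdf c k s) = hypoexp_cdf c k s"
    by (simp add: mult.assoc[symmetric] exp_add[symmetric])
  finally have "((\<lambda>s. c k * exp (- c k * s) * ?I s) has_real_derivative
      c k * (hypoexp_cdf c k s - c k * exp (- c k * s) * ?I s)) (at s within {0..})" .
  moreover have "hypoexp_cdf c (Suc k) = (\<lambda>s. c k * exp (- c k * s) * ?I s)" by (simp add: fun_eq_iff)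
  ultimately show ?thesis by simp
qed

lemma continuous_on_hypoexp_cdf: "continuous_on {0..} (hypoexp_cdf c k)"
proof (induction k)
  case (Suc k)
  show ?case
    by (rule DERIV_continuous_on) (rule hypoexp_cdf_deriv_aux[OF Suc], simp)
qed simp

lemma hypoexp_cdf_deriv:
  "0 \<le> s \<Longrightarrow> (hypoexp_cdf c (Suc k) has_real_derivative
     c k * (hypoexp_cdf c k s - hypoexp_cdf c (Suc k) s)) (at s within {0..})"
  by (rule hypoexp_cdf_deriv_aux[OF continuous_on_hypoexp_cdf])

lemma hypoexp_cdf_nonneg:
  assumes "\<And>i. i < k \<Longrightarrow> 0 \<le> c i" and "0 \<le> s"
  shows "0 \<le> hypoexp_cdf c k s"
  using assms
proof (induction k arbitrary: s)
  case (Suc k)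
  have "0 \<le> c k * hypoexp_cdf c k u" if "0 \<le> u" for u
    using Suc that by simp
  moreover have "hypoexp_cdf c (Suc k) 0 = 0" by simp
  ultimately show ?case
    by (intro nonneg_of_deriv_ge[where c="c k" and g="hypoexp_cdf c (Suc k)" and s=s, OF hypoexp_cdf_deriv])
       (use Suc.prems in \<open>auto simp: algebra_simps simp del: hypoexp_cdf.simps(2)\<close>)
qed simp

text \<open>Discarding the loss term and bounding the rate by \<open>C\<close> leaves a derivative
  no larger than that of the majorant; at level \<open>Suc k\<close> both sides vanish at
  \<open>0\<close>.\<close>

lemma hypoexp_cdf_le:
  assumes "\<And>i. i < k \<Longrightarrow> 0 \<le> c i \<and> c i \<le> C" and "0 \<le> s"
  shows "hypoexp_cdf c k s \<le> (C * s) ^ k / fact k"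
  using assms
proof (induction k arbitrary: s)
  case (Suc k)
  let ?g = "\<lambda>s. (C * s) ^ Suc k / fact (Suc k) - hypoexp_cdf c (Suc k) s"
  let ?g' = "\<lambda>s. C * ((C * s) ^ k / fact k) - c k * (hypoexp_cdf c k s - hypoexp_cdf c (Suc k) s)"
  have "0 \<le> ?g s"
  proof (rule nonneg_of_deriv_ge[where c=0 and g="?g" and g'="?g'"])
    fix s :: real assume s: "0 \<le> s"
    from DERIV_diff[OF has_real_derivative_power_over_fact hypoexp_cdf_deriv[OF s, of c k]]
    show "(?g has_real_derivative ?g' s) (at s within {0..})" .
    have nn: "0 \<le> hypoexp_cdf c k s" "0 \<le> hypoexp_cdf c (Suc k) s"
      using hypoexp_cdf_nonneg[of _ c s] Suc.prems s by (auto simp del: hypoexp_cdf.simps)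
    have "c k * (hypoexp_cdf c k s - hypoexp_cdf c (Suc k) s) \<le> c k * hypoexp_cdf c k s"
      using nn Suc.prems(1)[of k] by (intro mult_left_mono) auto
    also have "\<dots> \<le> C * ((C * s) ^ k / fact k)"
      using nn Suc.prems(1)[of k] Suc.IH[of s] Suc.prems s by (intro mult_mono) (auto intro: order_trans)
    finally show "- 0 * ?g s \<le> ?g' s" by simp
  qed (use Suc.prems in auto)
  then show ?case by (simp del: hypoexp_cdf.simps)
qed simp

text \<open>Induction on the number of summands: the sum \<open>S\<close> of the first
  \<open>k\<close> is independent of the last clock, so the probability is the mean, over the value
  \<open>x\<close> of that clock, of the distribution function of \<open>S\<close> at
  \<open>s - x / c k\<close>.\<close>

lemma (in prob_space) prob_sum_exponential_le:
  fixes \<gamma> :: "nat \<Rightarrow> 'a \<Rightarrow> real" and c :: "nat \<Rightarrow> real"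
  assumes indep: "indep_vars (\<lambda>_. borel) \<gamma> {1..}"
    and dist: "\<And>k. 1 \<le> k \<Longrightarrow> distributed M lborel (\<gamma> k) (exponential_density 1)"
    and c: "\<And>i. i < k \<Longrightarrow> 0 < c i" and "0 \<le> s"
  shows "prob {\<omega> \<in> space M. (\<Sum>i\<in>{1..k}. \<gamma> i \<omega> / c (i - 1)) \<le> s} = hypoexp_cdf c k s"
  using c \<open>0 \<le> s\<close>
proof (induction k arbitrary: s)
  case 0
  then show ?case by (simp add: prob_space)
next
  case (Suc k)
  have [measurable]: "\<gamma> i \<in> borel_measurable M" if "1 \<le> i" for i
    using distributed_measurable[OF dist[OF that]] by simp
  define S where "S = (\<lambda>\<omega>. \<Sum>i\<in>{1..k}. \<gamma> i \<omega> / c (i - 1))"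
  have mS[measurable]: "S \<in> borel_measurable M"
    unfolding S_def by measurable
  let ?X = "\<lambda>i \<omega>. if i = Suc k then \<gamma> i \<omega> else \<gamma> i \<omega> / c (i - 1)"
  have "indep_vars (\<lambda>_. borel) (\<lambda>i \<omega>. (\<lambda>x. if i = Suc k then x else x / c (i - 1)) (\<gamma> i \<omega>)) (insert (Suc k) {1..k})"
    by (rule indep_vars_compose2[OF indep_vars_subset[OF indep]]) auto
  then have "indep_var borel (?X (Suc k)) borel (\<lambda>\<omega>. \<Sum>i\<in>{1..k}. ?X i \<omega>)"
    by (intro indep_vars_sum) auto
  also have "?X (Suc k) = \<gamma> (Suc k)" by simp
  also have "(\<lambda>\<omega>. \<Sum>i\<in>{1..k}. ?X i \<omega>) = S" unfolding S_def by (auto simp: fun_eq_iff)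
  finally have ind: "indep_var borel (\<gamma> (Suc k)) borel S" .
  have pair: "distr M borel (\<gamma> (Suc k)) \<Otimes>\<^sub>M distr M borel S
      = distr M (borel \<Otimes>\<^sub>M borel) (\<lambda>\<omega>. (\<gamma> (Suc k) \<omega>, S \<omega>))"
    using ind by (simp add: indep_var_distribution_eq)
  have dg: "distr M borel (\<gamma> (Suc k)) = density lborel (\<lambda>x. ennreal (exponential_density 1 x))"
  proof -
    have "distr M borel (\<gamma> (Suc k)) = distr M lborel (\<gamma> (Suc k))" by (rule distr_cong) auto
    then show ?thesis using distributed_distr_eq_density[OF dist[of "Suc k"]] by simp
  qed
  have ck: "0 < c k" using Suc by simp
  \<comment> \<open>\<open>hypoexp_cdf\<close> is a distribution function only on the half-line, so
    mass of \<open>S\<close> below \<open>0\<close> has to be excluded separately.\<close>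
  have S_nonneg: "AE \<omega> in M. 0 \<le> S \<omega>"
  proof -
    have "AE \<omega> in M. 0 \<le> \<gamma> i \<omega>" if "1 \<le> i" for i
    proof -
      have "AE x in distr M lborel (\<gamma> i). 0 \<le> x"
        unfolding distributed_distr_eq_density[OF dist[OF that]]
        by (subst AE_density) (auto simp: exponential_density_def)
      then show ?thesis
        using that by (subst (asm) AE_distr_iff) auto
    qed
    then have "AE \<omega> in M. \<forall>i\<in>{1..k}. 0 \<le> \<gamma> i \<omega>"
      by (subst AE_ball_countable) auto
    then show ?thesis
    proof (rule AE_mp, intro AE_I2 impI)
      fix \<omega> assume "\<forall>i\<in>{1..k}. 0 \<le> \<gamma> i \<omega>"
      then show "0 \<le> S \<omega>" unfolding S_def
        by (intro sum_nonneg divide_nonneg_pos) (use Suc.prems in auto)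
    qed
  qed
  have eS: "emeasure (distr M borel S) {..u} = ennreal (hypoexp_cdf c k u) * indicator {0..} u" for u
  proof (cases "0 \<le> u")
    case True
    have "emeasure (distr M borel S) {..u} = emeasure M {\<omega> \<in> space M. S \<omega> \<le> u}"
      by (subst emeasure_distr) (auto intro!: arg_cong[where f="emeasure M"])
    also have "\<dots> = ennreal (hypoexp_cdf c k u)"
      using Suc.IH[of u] Suc.prems True by (simp add: emeasure_eq_measure S_def)
    finally show ?thesis using True by simp
  next
    case False
    have "emeasure (distr M borel S) {..u} = emeasure M {\<omega> \<in> space M. S \<omega> \<le> u}"
      by (subst emeasure_distr) (auto intro!: arg_cong[where f="emeasure M"])
    also have "\<dots> = 0"
      using S_nonneg False by (subst emeasure_eq_0_AE) auto
    finally show ?thesis using False by simp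
  qed
  have Hcont: "continuous_on {0..} (hypoexp_cdf c k)" by (rule continuous_on_hypoexp_cdf)
  let ?A = "{p :: real \<times> real. snd p \<le> s - fst p / c k}"
  have A: "?A \<in> sets (borel \<Otimes>\<^sub>M borel)"
  proof -
    have "{p \<in> space (borel \<Otimes>\<^sub>M borel). snd p \<le> s - fst p / c k} \<in> sets (borel \<Otimes>\<^sub>M borel)"
      by measurable
    then show ?thesis by (simp add: space_pair_measure)
  qed
  interpret DS: prob_space "distr M borel S" by (rule prob_space_distr) measurable
  have "emeasure M {\<omega> \<in> space M. (\<Sum>i\<in>{1..Suc k}. \<gamma> i \<omega> / c (i - 1)) \<le> s}
      = emeasure (distr M (borel \<Otimes>\<^sub>M borel) (\<lambda>\<omega>. (\<gamma> (Suc k) \<omega>, S \<omega>))) ?A"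
    using A by (subst emeasure_distr) (auto simp: S_def intro!: arg_cong[where f="emeasure M"])
  also have "\<dots> = emeasure (distr M borel (\<gamma> (Suc k)) \<Otimes>\<^sub>M distr M borel S) ?A"
    by (simp add: pair)
  also have "\<dots> = (\<integral>\<^sup>+x. emeasure (distr M borel S) (Pair x -` ?A) \<partial>distr M borel (\<gamma> (Suc k)))"
    by (rule DS.emeasure_pair_measure_alt) (use A in simp)
  also have "\<dots> = (\<integral>\<^sup>+x. ennreal (exponential_density 1 x) * emeasure (distr M borel S) {..s - x / c k} \<partial>lborel)"
    unfolding dg vimage_def mem_Collect_eq fst_conv snd_conv atMost_def
  proof (subst nn_integral_density)
    have "(\<lambda>x. emeasure (distr M borel S) (Pair x -` ?A)) \<in> borel_measurable borel"
      by (rule DS.measurable_emeasure_Pair) (use A in simp)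
    then show "(\<lambda>x. emeasure (distr M borel S) {xa. xa \<le> s - x / c k}) \<in> borel_measurable lborel"
      by (simp add: vimage_def)
  qed auto
  also have "\<dots> = (\<integral>\<^sup>+x. ennreal (exponential_density 1 x) * 
      (ennreal (hypoexp_cdf c k (s - x / c k)) * indicator {0..} (s - x / c k)) \<partial>lborel)"
    by (simp only: eS)
  \<comment> \<open>The substitution \<open>x = c k * s - c k * u\<close>, that is
    \<open>u = s - x / c k\<close>: the exponential density becomes
    \<open>exp (- c k * s) * exp (c k * u)\<close>, and the Jacobian is the factor
    \<open>c k\<close> of the recursion.\<close>
  also have "\<dots> = ennreal \<bar>- c k\<bar> * (\<integral>\<^sup>+u. ennreal (exponential_density 1 (c k * s + (- c k) * u)) * 
      (ennreal (hypoexp_cdf c k (s - (c k * s + (- c k) * u) / c k)) * indicator {0..} (s - (c k * s + (- c k) * u) / c k)) \<partial>lborel)"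
  proof (rule nn_integral_real_affine)
    have "(\<lambda>x. emeasure (distr M borel S) (Pair x -` ?A)) \<in> borel_measurable borel"
      by (rule DS.measurable_emeasure_Pair) (use A in simp)
    then have "(\<lambda>x. emeasure (distr M borel S) {..s - x / c k}) \<in> borel_measurable borel"
      by (simp add: vimage_def atMost_def)
    then show "(\<lambda>x. ennreal (exponential_density 1 x) * 
      (ennreal (hypoexp_cdf c k (s - x / c k)) * indicator {0..} (s - x / c k))) \<in> borel_measurable borel"
      unfolding eS by measurable
  qed (use ck in auto)
  also have "\<dots> = ennreal (c k) * (\<integral>\<^sup>+u. ennreal (exp (- c k * s) * (exp (c k * u) * hypoexp_cdf c k u)) * indicator {0..s} u \<partial>lborel)"
  proof -
    have "s - (c k * s + (- c k) * u) / c k = u" for u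
      using ck by (simp add: field_simps)
    moreover have "ennreal (exponential_density 1 (c k * s + (- c k) * u)) * (ennreal (hypoexp_cdf c k u) * indicator {0..} u)
      = ennreal (exp (- c k * s) * (exp (c k * u) * hypoexp_cdf c k u)) * indicator {0..s} u" for u
    proof -
      have "c k * s + (- c k) * u < 0 \<longleftrightarrow> s < u" using ck by simp
      moreover have "exp (- (c k * s + (- c k) * u)) = exp (- c k * s) * exp (c k * u)"
        by (simp add: exp_add[symmetric])
      ultimately show ?thesis
        unfolding exponential_density_def
        by (auto simp: indicator_def ennreal_mult'[symmetric] mult.assoc)
    qed
    ultimately show ?thesis using ck by simp
  qed
  also have "(\<integral>\<^sup>+u. ennreal (exp (- c k * s) * (exp (c k * u) * hypoexp_cdf c k u)) * indicator {0..s} u \<partial>lborel)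
     = ennreal (exp (- c k * s) * integral {0..s} (\<lambda>u. exp (c k * u) * hypoexp_cdf c k u))"
  proof -
    have ci: "continuous_on {0..s} (\<lambda>u. exp (c k * u) * hypoexp_cdf c k u)"
      by (intro continuous_intros continuous_on_subset[OF Hcont]) auto
    have nn: "0 \<le> hypoexp_cdf c k u" if "0 \<le> u" for u
      using that Suc.prems by (intro hypoexp_cdf_nonneg) (auto simp: less_imp_le)
    let ?f = "\<lambda>u. exp (- c k * s) * (exp (c k * u) * hypoexp_cdf c k u)"
    have hi: "(?f has_integral (exp (- c k * s) * integral {0..s} (\<lambda>u. exp (c k * u) * hypoexp_cdf c k u))) {0..s}"
      by (intro has_integral_mult_right integrable_integral integrable_continuous_real ci)
    let ?g = "\<lambda>u. if u \<in> {0..s} then ?f u else 0"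
    have "(\<integral>\<^sup>+u. ennreal (?g u) \<partial>lborel) = ennreal (exp (- c k * s) * integral {0..s} (\<lambda>u. exp (c k * u) * hypoexp_cdf c k u))"
    proof (rule nn_integral_has_integral_lborel)
      show "?g \<in> borel_measurable borel"
        by (rule borel_measurable_continuous_on_if)
           (auto intro!: continuous_intros continuous_on_subset[OF Hcont])
      show "(?g has_integral (exp (- c k * s) * integral {0..s} (\<lambda>u. exp (c k * u) * hypoexp_cdf c k u))) UNIV"
        using hi by (simp only: has_integral_restrict_UNIV)
    qed (use nn in auto)
    moreover have "(\<integral>\<^sup>+u. ennreal (?g u) \<partial>lborel) = (\<integral>\<^sup>+u. ennreal (?f u) * indicator {0..s} u \<partial>lborel)"
      by (rule nn_integral_cong) (auto simp: indicator_def)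
    ultimately show ?thesis by simp
  qed
  also have "ennreal (c k) * \<dots> = ennreal (hypoexp_cdf c (Suc k) s)"
    using ck by (simp add: ennreal_mult'[symmetric] mult.assoc)
  finally have "emeasure M {\<omega> \<in> space M. (\<Sum>i\<in>{1..Suc k}. \<gamma> i \<omega> / c (i - 1)) \<le> s} = ennreal (hypoexp_cdf c (Suc k) s)" .
  moreover have "0 \<le> hypoexp_cdf c (Suc k) s"
    using Suc.prems by (intro hypoexp_cdf_nonneg) (auto simp: less_imp_le)
  ultimately show ?case by (simp add: measure_def del: hypoexp_cdf.simps)
qed

section \<open>Jump counts of a stationary chain\<close>

text \<open>Think of \<open>W k l s\<close> as the probability that the \<open>k\<close>-th state is \<open>l\<close> and has been left by time \<open>s\<close>,
  and of \<open>a k l s\<close> as the probability that it is \<open>l\<close> and has been entered by time \<open>s\<close>.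
  Then \<open>B K l s\<close> in the proof is the probability of being in \<open>l\<close> at time \<open>s\<close> after at most \<open>K\<close> jumps.
  It never exceeds the stationary weight, and the total deficit is the probability of more than \<open>K\<close>
  jumps; this replaces a uniqueness theorem for the Kolmogorov equation.\<close>

lemma stationary_jump_count_limit:
  fixes W a :: "nat \<Rightarrow> nat \<Rightarrow> real \<Rightarrow> real" and T :: "nat \<Rightarrow> nat \<Rightarrow> real" and c \<sigma> :: "nat \<Rightarrow> real"
  assumes der: "\<And>k l s. l \<le> n \<Longrightarrow> 0 \<le> s \<Longrightarrow>
      (W k l has_real_derivative c l * (a k l s - W k l s)) (at s within {0..})"
    and W_0: "\<And>k l. l \<le> n \<Longrightarrow> W k l 0 = 0"
    and W_nonneg: "\<And>k l s. l \<le> n \<Longrightarrow> 0 \<le> s \<Longrightarrow> 0 \<le> W k l s"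
    and a_0: "\<And>l s. l \<le> n \<Longrightarrow> 0 \<le> s \<Longrightarrow> a 0 l s = \<sigma> l"
    and a_Suc: "\<And>k l s. l \<le> n \<Longrightarrow> 0 \<le> s \<Longrightarrow> a (Suc k) l s = (\<Sum>m\<le>n. T m l * W k m s)"
    and T_nonneg: "\<And>m l. m \<le> n \<Longrightarrow> l \<le> n \<Longrightarrow> 0 \<le> T m l"
    and T_sum: "\<And>m. m \<le> n \<Longrightarrow> (\<Sum>l\<le>n. T m l) = 1"
    and c: "\<And>l. l \<le> n \<Longrightarrow> 0 \<le> c l \<and> c l \<le> C"
    and stationary: "\<And>l. l \<le> n \<Longrightarrow> (\<Sum>m\<le>n. \<sigma> m * c m * T m l) = c l * \<sigma> l"
    and bound: "\<And>k s. 0 \<le> s \<Longrightarrow> (\<Sum>l\<le>n. W k l s) \<le> (C * s) ^ Suc k / fact (Suc k)"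
    and l: "l \<le> n" and s: "0 \<le> s"
  shows "(\<lambda>K. \<Sum>k<K. W k l s) \<longlonglongrightarrow> c l * \<sigma> l * s"
proof -
  define V where "V K l s = (\<Sum>k<K. W k l s)" for K l s
  \<comment> \<open>Entries minus departures for the states \<open>0, ..., K\<close>. Entering state
    \<open>k + 1\<close> is the same jump as leaving state \<open>k\<close>, so the inflow uses
    \<open>V K\<close> and the outflow \<open>V (Suc K)\<close>.\<close>
  define B where "B K l s = \<sigma> l + (\<Sum>m\<le>n. T m l * V K m s) - V (Suc K) l s" for K l s
  have V_0: "V K l 0 = 0" if "l \<le> n" for K l
    using W_0 that by (simp add: V_def)
  have sum_a: "(\<Sum>k<Suc K. a k l s) = \<sigma> l + (\<Sum>m\<le>n. T m l * V K m s)" if "l \<le> n" "0 \<le> s" for K l s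
  proof -
    have "(\<Sum>k<Suc K. a k l s) = \<sigma> l + (\<Sum>k<K. \<Sum>m\<le>n. T m l * W k m s)"
      using that by (simp only: sum.lessThan_Suc_shift a_0 a_Suc)
    also have "(\<Sum>k<K. \<Sum>m\<le>n. T m l * W k m s) = (\<Sum>m\<le>n. T m l * V K m s)"
      unfolding V_def sum_distrib_left by (rule sum.swap)
    finally show ?thesis .
  qed
  have V_der: "(V (Suc K) l has_real_derivative c l * B K l s) (at s within {0..})"
    if "l \<le> n" "0 \<le> s" for K l s
  proof -
    have "((\<lambda>s. \<Sum>k<Suc K. W k l s) has_real_derivative (\<Sum>k<Suc K. c l * (a k l s - W k l s))) (at s within {0..})"
      using that by (intro DERIV_sum der)
    also have "(\<Sum>k<Suc K. c l * (a k l s - W k l s)) = c l * ((\<Sum>k<Suc K. a k l s) - V (Suc K) l s)"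
      unfolding V_def sum_distrib_left[symmetric] sum_subtractf ..
    also have "\<dots> = c l * B K l s" using that by (simp only: sum_a B_def)
    finally show ?thesis by (simp only: V_def[abs_def])
  qed
  \<comment> \<open>Comparison with the constant solution \<open>\<sigma>\<close>: by induction the
    inflow computed from \<open>B K\<close> is at most the one computed from
    \<open>\<sigma>\<close>, which stationarity makes equal to the outflow
    \<open>c l * \<sigma> l\<close>.\<close>
  have B_le: "B K l s \<le> \<sigma> l" if "l \<le> n" "0 \<le> s" for K l s
    using that
  proof (induction K arbitrary: l s)
    case 0
    then show ?case using W_nonneg by (simp add: B_def V_def)
  next
    case (Suc K)
    have "0 \<le> \<sigma> l - B (Suc K) l s"
    proof (rule nonneg_of_deriv_ge[where c="c l" and g="\<lambda>s. \<sigma> l - B (Suc K) l s"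
          and g'="\<lambda>s. - ((\<Sum>m\<le>n. T m l * (c m * B K m s)) - c l * B (Suc K) l s)"])
      fix s :: real assume s: "0 \<le> s"
      show "((\<lambda>s. \<sigma> l - B (Suc K) l s) has_real_derivative
          - ((\<Sum>m\<le>n. T m l * (c m * B K m s)) - c l * B (Suc K) l s)) (at s within {0..})"
        unfolding B_def[of "Suc K"] diff_add_eq_diff_diff_swap[symmetric]
      proof -
        have "((\<lambda>s. (\<Sum>m\<le>n. T m l * V (Suc K) m s) - V (Suc (Suc K)) l s) has_real_derivative
            (\<Sum>m\<le>n. T m l * (c m * B K m s)) - c l * B (Suc K) l s) (at s within {0..})"
          using Suc.prems s by (intro DERIV_diff DERIV_sum DERIV_cmult V_der) auto
        from DERIV_minus[OF this]
        show "((\<lambda>s. \<sigma> l - (\<sigma> l + (\<Sum>m\<le>n. T m l * V (Suc K) m s) - V (Suc (Suc K)) l s)) has_real_derivative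
          - ((\<Sum>m\<le>n. T m l * (c m * B K m s)) - c l * (\<sigma> l + (\<Sum>m\<le>n. T m l * V (Suc K) m s) - V (Suc (Suc K)) l s))) (at s within {0..})"
          by (simp add: B_def[of "Suc K"] algebra_simps)
      qed
      have "(\<Sum>m\<le>n. T m l * (c m * B K m s)) \<le> (\<Sum>m\<le>n. \<sigma> m * c m * T m l)"
      proof (rule sum_mono)
        fix m assume "m \<in> {..n}"
        then have "T m l * (c m * B K m s) \<le> T m l * (c m * \<sigma> m)"
          using Suc s T_nonneg c by (intro mult_left_mono) auto
        then show "T m l * (c m * B K m s) \<le> \<sigma> m * c m * T m l" by (simp add: mult_ac)
      qed
      then show "- c l * (\<sigma> l - B (Suc K) l s) \<le> - ((\<Sum>m\<le>n. T m l * (c m * B K m s)) - c l * B (Suc K) l s)"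
        using stationary[OF Suc.prems(1)] by (simp add: algebra_simps)
    qed (use Suc.prems in \<open>auto simp: B_def V_0\<close>)
    then show ?case by simp
  qed
  \<comment> \<open>A single deficit is at most the sum of all, since none is negative. As the rows
    of \<open>T\<close> sum to \<open>1\<close>, that sum telescopes to the one layer
    \<open>W K\<close>.\<close>
  have B_ge: "\<sigma> l - B K l s \<le> (C * s) ^ Suc K / fact (Suc K)" if "l \<le> n" "0 \<le> s" for K l s
  proof -
    have "\<sigma> l - B K l s \<le> (\<Sum>l\<le>n. \<sigma> l - B K l s)"
      using that B_le by (intro member_le_sum) auto
    also have "\<dots> = (\<Sum>l\<le>n. V (Suc K) l s) - (\<Sum>l\<le>n. \<Sum>m\<le>n. T m l * V K m s)"
      by (simp add: B_def sum_subtractf sum.distrib)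
    also have "(\<Sum>l\<le>n. \<Sum>m\<le>n. T m l * V K m s) = (\<Sum>m\<le>n. (\<Sum>l\<le>n. T m l) * V K m s)"
      unfolding sum_distrib_right by (rule sum.swap)
    also have "\<dots> = (\<Sum>m\<le>n. V K m s)" by (simp add: T_sum)
    also have "(\<Sum>l\<le>n. V (Suc K) l s) - (\<Sum>m\<le>n. V K m s) = (\<Sum>l\<le>n. W K l s)"
      by (simp add: V_def sum.distrib)
    also have "\<dots> \<le> (C * s) ^ Suc K / fact (Suc K)" using that by (intro bound)
    finally show ?thesis .
  qed
  have D_der: "((\<lambda>s. c l * \<sigma> l * s - V (Suc K) l s) has_real_derivative c l * (\<sigma> l - B K l s)) (at s within {0..})"
    if "0 \<le> s" for K s
    using DERIV_diff[OF DERIV_cmult_Id[of "c l * \<sigma> l"] V_der[OF l that, of K]] by (simp add: algebra_simps)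
  \<comment> \<open>The error \<open>c l * \<sigma> l * s - V (Suc K) l s\<close> has derivative
    \<open>c l\<close> times the deficit, so integrating the two bounds on the deficit encloses it;
    integration raises the exponent by one.\<close>
  have low: "0 \<le> c l * \<sigma> l * s - V (Suc K) l s" for K
    by (rule nonneg_of_deriv_ge[where c=0 and g="\<lambda>s. c l * \<sigma> l * s - V (Suc K) l s", OF D_der])
       (use B_le c l s V_0 in auto)
  have up: "c l * \<sigma> l * s - V (Suc K) l s \<le> (C * s) ^ Suc (Suc K) / fact (Suc (Suc K))" for K
  proof -
    have "0 \<le> (C * s) ^ Suc (Suc K) / fact (Suc (Suc K)) - (c l * \<sigma> l * s - V (Suc K) l s)"
    proof (rule nonneg_of_deriv_ge[where c=0 and
          g="\<lambda>s. (C * s) ^ Suc (Suc K) / fact (Suc (Suc K)) - (c l * \<sigma> l * s - V (Suc K) l s)"])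
      fix s :: real assume s: "0 \<le> s"
      show "((\<lambda>s. (C * s) ^ Suc (Suc K) / fact (Suc (Suc K)) - (c l * \<sigma> l * s - V (Suc K) l s)) has_real_derivative
          C * ((C * s) ^ Suc K / fact (Suc K)) - c l * (\<sigma> l - B K l s)) (at s within {0..})"
        by (rule DERIV_diff[OF has_real_derivative_power_over_fact D_der[OF s]])
      have "c l * (\<sigma> l - B K l s) \<le> C * ((C * s) ^ Suc K / fact (Suc K))"
        using B_ge[OF l s, of K] B_le[OF l s, of K] c[OF l] by (intro mult_mono) auto
      then show "- 0 * ((C * s) ^ Suc (Suc K) / fact (Suc (Suc K)) - (c l * \<sigma> l * s - V (Suc K) l s))
          \<le> C * ((C * s) ^ Suc K / fact (Suc K)) - c l * (\<sigma> l - B K l s)" by simp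
    qed (use l s V_0 in auto)
    then show ?thesis by simp
  qed
  have "(\<lambda>K. c l * \<sigma> l * s - V (Suc K) l s) \<longlonglongrightarrow> 0"
  proof (rule tendsto_sandwich[OF _ _ tendsto_const])
    show "(\<lambda>K. (C * s) ^ Suc (Suc K) / fact (Suc (Suc K))) \<longlonglongrightarrow> 0"
      by (rule LIMSEQ_Suc[OF LIMSEQ_Suc[OF power_over_fact_tendsto_0]])
  qed (use low up in auto)
  from tendsto_diff[OF tendsto_const[of "c l * \<sigma> l * s"] this]
  have "(\<lambda>K. V (Suc K) l s) \<longlonglongrightarrow> c l * \<sigma> l * s" by simp
  then show ?thesis unfolding V_def by (rule LIMSEQ_imp_Suc)
qed

section \<open>The jump kernel\<close>

text \<open>The case \<open>card_psi n \<psi> = 1\<close> of a detachment needs no separate clause, because \<open>1 / 0 = 0\<close>.\<close>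

definition move :: "nat \<Rightarrow> nat \<Rightarrow> 'N::finite state \<Rightarrow> real^'N \<Rightarrow> 'N state" where
  "move n i x y = (s_i i (fst x),
     if fst x i
     then (snd x)(n := snd x n - (1 / (real (card_psi n (fst x)) - 1)) *\<^sub>R (snd x i - snd x n))
     else (snd x)(i := y + snd x n, n := (1 / (real (card_psi n (fst x)) + 1)) *\<^sub>R y + snd x n))"

lemma card_psi_le: "card_psi n \<psi> \<le> n"
proof -
  have "card {i. i < n \<and> \<psi> i} \<le> card {..<n}" by (rule card_mono) auto
  then show ?thesis by (simp add: card_psi_def)
qed

lemma card_psi_eq_sum: "card_psi n \<psi> = (\<Sum>i<n. of_bool (\<psi> i))"
proof -
  have "{i. i < n \<and> \<psi> i} = {..<n} \<inter> {i. \<psi> i}" by auto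
  then show ?thesis by (simp add: card_psi_def of_bool_def sum.If_cases)
qed

lemma card_psi_pos: "i < n \<Longrightarrow> \<psi> i \<Longrightarrow> 0 < card_psi n \<psi>"
  unfolding card_psi_def by (subst card_gt_0_iff) auto

lemma card_psi_s_i:
  assumes "i < n"
  shows "card_psi n (s_i i \<psi>) = (if \<psi> i then card_psi n \<psi> - 1 else Suc (card_psi n \<psi>))"
proof -
  have "{j. j < n \<and> s_i i \<psi> j} = (if \<psi> i then {j. j < n \<and> \<psi> j} - {i} else insert i {j. j < n \<and> \<psi> j})"
    using assms by (auto simp: s_i_def)
  then show ?thesis using assms by (auto simp: card_psi_def)
qed

lemma sum_of_bool_psi:
  "(\<Sum>i<n. of_bool (\<psi> i) :: real) = real (card_psi n \<psi>)"
  by (simp add: card_psi_eq_sum)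

text \<open>The centroid moves by \<open>d\<close>, so each of the other attached objects loses
  \<open>d\<close> relative to it, and the old balance supplies the sum of their old displacements.
  \<open>d\<close> is the value for which these contributions cancel, together with that of a newly
  attached object.\<close>

lemma move_in_Xset:
  assumes x: "x \<in> Xset n" and i: "i < n"
  shows "move n i x y \<in> Xset n"
proof -
  obtain \<psi> v where x_eq: "x = (\<psi>, v)" by (cases x)
  let ?k = "card_psi n \<psi>"
  have ext: "\<psi> \<in> extensional {..<n}" "v \<in> extensional {..<Suc n}"
    and bal: "(\<Sum>j<n. of_bool (\<psi> j) *\<^sub>R (v j - v n)) = 0"
    using x by (auto simp: Xset_def x_eq)
  have e1: "s_i i \<psi> \<in> extensional {..<n}"
    using ext(1) i by (auto simp: extensional_def s_i_def)
  have e2: "snd (move n i x y) \<in> extensional {..<Suc n}"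
    using ext(2) i by (auto simp: extensional_def move_def x_eq)
  define w where "w = snd (move n i x y)"
  have split: "(\<Sum>j<n. f j) = f i + (\<Sum>j\<in>{..<n}-{i}. f j)" for f :: "nat \<Rightarrow> real^'a"
    using i by (subst sum.remove[of _ i]) auto
  have cardsum: "(\<Sum>j<n. of_bool (\<psi> j)) = real ?k" by (rule sum_of_bool_psi)
  have rest: "(\<Sum>j\<in>{..<n}-{i}. of_bool (\<psi> j) :: real) = real ?k - of_bool (\<psi> i)"
    using i cardsum by (subst (asm) sum.remove[of _ i]) auto
  have wj: "w j = v j" if "j < n" "j \<noteq> i" for j
    using that by (simp add: w_def move_def x_eq)
  define d where "d = (if \<psi> i then - (1 / (real ?k - 1)) *\<^sub>R (v i - v n) else (1 / (real ?k + 1)) *\<^sub>R y)"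
  have wn: "w n = v n + d" by (simp add: d_def w_def move_def x_eq algebra_simps)
  have s1: "(\<Sum>j\<in>{..<n}-{i}. of_bool (\<psi> j) *\<^sub>R (w j - w n))
      = (\<Sum>j\<in>{..<n}-{i}. of_bool (\<psi> j) *\<^sub>R (v j - v n)) - (real ?k - of_bool (\<psi> i)) *\<^sub>R d"
  proof -
    have "(\<Sum>j\<in>{..<n}-{i}. of_bool (\<psi> j) *\<^sub>R (w j - w n)) = (\<Sum>j\<in>{..<n}-{i}. of_bool (\<psi> j) *\<^sub>R (v j - v n) - of_bool (\<psi> j) *\<^sub>R d)"
      by (intro sum.cong) (auto simp: wj wn algebra_simps)
    then show ?thesis by (simp only: sum_subtractf scaleR_left.sum[symmetric] rest)
  qed
  have s2: "(\<Sum>j\<in>{..<n}-{i}. of_bool (\<psi> j) *\<^sub>R (v j - v n)) = - (of_bool (\<psi> i) *\<^sub>R (v i - v n))"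
    using bal by (subst (asm) split) (simp add: eq_neg_iff_add_eq_0 add.commute)
  have "(\<Sum>j<n. of_bool (s_i i \<psi> j) *\<^sub>R (w j - w n))
      = of_bool (\<not> \<psi> i) *\<^sub>R (w i - w n) + (\<Sum>j\<in>{..<n}-{i}. of_bool (\<psi> j) *\<^sub>R (w j - w n))"
    by (subst split) (auto simp: s_i_def intro!: sum.cong)
  also have "\<dots> = 0"
  proof (cases "\<psi> i")
    case True
    have kpos: "0 < ?k" using card_psi_pos[of i n \<psi>] i True by simp
    show ?thesis
    proof (cases "?k = 1")
      \<comment> \<open>Here the coefficient is \<open>1 / 0 = 0\<close> and nothing cancels;
        instead no object remains attached, so every summand vanishes.\<close>
      case True
      have "\<psi> j \<longleftrightarrow> False" if "j \<in> {..<n}-{i}" for j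
      proof -
        have "(of_bool (\<psi> j) :: real) \<le> (\<Sum>j\<in>{..<n}-{i}. of_bool (\<psi> j))"
          by (rule member_le_sum) (use that in auto)
        also have "\<dots> = 0" using rest True \<open>\<psi> i\<close> by simp
        finally show ?thesis by (cases "\<psi> j") auto
      qed
      then have "(\<Sum>j\<in>{..<n}-{i}. of_bool (\<psi> j) *\<^sub>R (w j - w n)) = 0"
        by (intro sum.neutral) auto
      then show ?thesis using \<open>\<psi> i\<close> by simp
    next
      case False
      then have "real ?k - 1 \<noteq> 0" using kpos by simp
      then show ?thesis unfolding s1 s2 d_def using True by simp
    qed
  next
    case False
    have wi: "w i = v n + y" using False i by (simp add: w_def move_def x_eq)
    have "y - d - real ?k *\<^sub>R d = y - (1 + real ?k) *\<^sub>R d" by (simp add: algebra_simps)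
    also have "\<dots> = 0" using False by (simp add: d_def add.commute)
    finally show ?thesis unfolding s1 s2 using False by (simp add: wi wn algebra_simps)
  qed
  finally show ?thesis using e1 e2 by (simp add: Xset_def move_def w_def x_eq)
qed

section \<open>Measurability of the state space and of a move\<close>

lemma space_stateM: "space (stateM n) = Xset n"
  by (auto simp: stateM_def space_restrict_space space_pair_measure space_PiM Xset_def PiE_def)

lemma measurable_fst_stateM[measurable]:
  "fst \<in> stateM n \<rightarrow>\<^sub>M PiM {..<n} (\<lambda>_. count_space UNIV)"
  unfolding stateM_def by (rule measurable_restrict_space1) measurable

lemma measurable_snd_stateM[measurable]:
  "snd \<in> (stateM n :: 'N::finite state measure) \<rightarrow>\<^sub>M PiM {..<Suc n} (\<lambda>_. borel)"
  unfolding stateM_def by (rule measurable_restrict_space1) measurable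

lemma measurable_status_stateM[measurable]:
  "j < n \<Longrightarrow> (\<lambda>x. fst x j) \<in> (stateM n :: 'N::finite state measure) \<rightarrow>\<^sub>M count_space UNIV"
  by measurable

lemma measurable_location_stateM[measurable]:
  "j \<le> n \<Longrightarrow> (\<lambda>x. snd x j) \<in> borel_measurable (stateM n :: 'N::finite state measure)"
  by (rule measurable_compose[OF measurable_snd_stateM measurable_component_singleton]) auto

lemma measurable_card_psi[measurable]:
  "(\<lambda>x. card_psi n (fst x)) \<in> (stateM n :: 'N::finite state measure) \<rightarrow>\<^sub>M count_space UNIV"
  unfolding card_psi_def
proof (rule measurable_card)
  fix i
  show "{x \<in> space (stateM n). i \<in> {i. i < n \<and> fst x i}} \<in> sets (stateM n :: 'N state measure)"
    using measurable_status_stateM[of i n, where 'N='N] by (cases "i < n") (auto simp: pred_def)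
qed

lemma measurable_move:
  assumes i: "i < n"
  shows "(\<lambda>p. move n i (fst p) (snd p)) \<in> (stateM n :: 'N::finite state measure) \<Otimes>\<^sub>M borel \<rightarrow>\<^sub>M stateM n"
proof -
  let ?P = "(stateM n :: 'N state measure) \<Otimes>\<^sub>M (borel :: (real^'N) measure)"
  have st[measurable]: "(\<lambda>p. fst (fst p) j) \<in> ?P \<rightarrow>\<^sub>M count_space UNIV" if "j < n" for j
    by (rule measurable_compose[OF measurable_fst measurable_status_stateM[OF that]])
  have loc[measurable]: "(\<lambda>p. snd (fst p) j) \<in> borel_measurable ?P" if "j \<le> n" for j
    by (rule measurable_compose[OF measurable_fst measurable_location_stateM[OF that]])
  have cd[measurable]: "(\<lambda>p. card_psi n (fst (fst p))) \<in> ?P \<rightarrow>\<^sub>M count_space UNIV"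
    by (rule measurable_compose[OF measurable_fst measurable_card_psi])
  have inX: "move n i (fst p) (snd p) \<in> Xset n" if "p \<in> space ?P" for p
    using that i by (intro move_in_Xset) (auto simp: space_pair_measure space_stateM)
  have m1: "(\<lambda>p. fst (move n i (fst p) (snd p))) \<in> ?P \<rightarrow>\<^sub>M PiM {..<n} (\<lambda>_. count_space UNIV)"
  proof (rule measurable_PiM_single')
    fix j assume "j \<in> {..<n}"
    then have [measurable]: "(\<lambda>p. fst (fst p) j) \<in> ?P \<rightarrow>\<^sub>M count_space UNIV" by (intro st) auto
    have [measurable]: "(\<lambda>p. fst (fst p) i) \<in> ?P \<rightarrow>\<^sub>M count_space UNIV" using i by (rule st)
    show "(\<lambda>p. fst (move n i (fst p) (snd p)) j) \<in> ?P \<rightarrow>\<^sub>M count_space UNIV"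
      by (cases "j = i") (simp_all add: move_def s_i_def)
  qed (use inX in \<open>force simp: Xset_def PiE_def\<close>)
  have m2: "(\<lambda>p. snd (move n i (fst p) (snd p))) \<in> ?P \<rightarrow>\<^sub>M PiM {..<Suc n} (\<lambda>_. borel)"
  proof (rule measurable_PiM_single')
    fix j assume "j \<in> {..<Suc n}"
    then have [measurable]: "(\<lambda>p. snd (fst p) j) \<in> borel_measurable ?P" by (intro loc) auto
    have [measurable]: "(\<lambda>p. fst (fst p) i) \<in> ?P \<rightarrow>\<^sub>M count_space UNIV" using i by (rule st)
    have [measurable]: "(\<lambda>p. snd (fst p) i) \<in> borel_measurable ?P" "(\<lambda>p. snd (fst p) n) \<in> borel_measurable ?P"
      using i by (auto intro!: loc)
    have eq: "snd (move n i (fst p) (snd p)) j =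
       (if fst (fst p) i then 
          if j = n then snd (fst p) n - (1 / (real (card_psi n (fst (fst p))) - 1)) *\<^sub>R (snd (fst p) i - snd (fst p) n)
          else snd (fst p) j
        else if j = n then (1 / (real (card_psi n (fst (fst p))) + 1)) *\<^sub>R snd p + snd (fst p) n
          else if j = i then snd p + snd (fst p) n else snd (fst p) j)" for p :: "'N state \<times> (real^'N)"
      by (simp add: move_def)
    show "(\<lambda>p. snd (move n i (fst p) (snd p)) j) \<in> borel_measurable ?P"
      unfolding eq by measurable
  qed (use inX in \<open>force simp: Xset_def PiE_def\<close>)
  have "(\<lambda>p. (fst (move n i (fst p) (snd p)), snd (move n i (fst p) (snd p)))) \<in> ?P \<rightarrow>\<^sub>M stateM n"
    unfolding stateM_def
    by (intro measurable_restrict_space2 measurable_Pair)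
       (use inX m1 m2 in \<open>auto simp: stateM_def\<close>)
  then show ?thesis by simp
qed

lemma measurable_move_compose[measurable (raw)]:
  assumes "i < n" and [measurable]: "f \<in> L \<rightarrow>\<^sub>M (stateM n :: 'N::finite state measure)" "g \<in> borel_measurable L"
  shows "(\<lambda>z. move n i (f z) (g z)) \<in> L \<rightarrow>\<^sub>M stateM n"
proof -
  have "(\<lambda>z. (f z, g z)) \<in> L \<rightarrow>\<^sub>M stateM n \<Otimes>\<^sub>M borel" by measurable
  from measurable_compose[OF this measurable_move[OF assms(1)]] show ?thesis by simp
qed

lemma measurable_r_i[measurable]:
  assumes "i < n"
  shows "(\<lambda>x. r_i \<theta>a \<theta>d n i (fst x)) \<in> borel_measurable (stateM n :: 'N::finite state measure)"
proof -
  have [measurable]: "(\<lambda>x. fst x i) \<in> (stateM n :: 'N::finite state measure) \<rightarrow>\<^sub>M count_space UNIV"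
    using assms by (rule measurable_status_stateM)
  have "(\<lambda>x. of_bool (fst x i) :: real) \<in> borel_measurable (stateM n :: 'N::finite state measure)"
    by (rule measurable_compose[where N="count_space UNIV"]) measurable
  then show ?thesis unfolding r_i_def by measurable
qed

text \<open>Every clause of \<open>lam_i\<close> is an image of \<open>\<eta>\<close> under
  \<open>move\<close>: for a detachment the move ignores the displacement, and \<open>\<eta>\<close>
  has total mass one.\<close>

lemma lam_i_eq_nn_integral:
  fixes \<eta> :: "(real^'N::finite) measure"
  assumes "prob_space \<eta>" and \<eta>: "sets \<eta> = sets borel" and x: "x \<in> Xset n" and i: "i < n"
    and B: "B \<in> sets (stateM n)"
  shows "ennreal (lam_i \<eta> n i x B) = (\<integral>\<^sup>+y. indicator B (move n i x y) \<partial>\<eta>)"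
proof -
  interpret prob_space \<eta> by fact
  note \<eta>[measurable_cong]
  have xs: "x \<in> space (stateM n)" using x by (simp add: space_stateM)
  have m[measurable]: "(\<lambda>y. move n i x y) \<in> \<eta> \<rightarrow>\<^sub>M stateM n"
    using i xs by measurable
  show ?thesis
  proof (cases "fst x i")
    case True
    then have "move n i x y = move n i x 0" for y by (simp add: move_def)
    moreover have "lam_i \<eta> n i x B = indicator B (move n i x 0)"
      using True by (cases "card_psi n (fst x) = 1") (simp_all add: lam_i_def Let_def move_def)
    moreover have "(\<integral>\<^sup>+y. indicator B (move n i x y) \<partial>\<eta>) = (\<integral>\<^sup>+y. indicator B (move n i x 0) \<partial>\<eta>)"
      using calculation(1) by metis
    ultimately show ?thesis by (simp add: emeasure_space_1 ennreal_indicator)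
  next
    case False
    then have "lam_i \<eta> n i x B = measure \<eta> {y \<in> space \<eta>. move n i x y \<in> B}"
      by (simp add: lam_i_def Let_def move_def)
    moreover have "(\<integral>\<^sup>+y. indicator B (move n i x y) \<partial>\<eta>) = (\<integral>\<^sup>+y. indicator {y \<in> space \<eta>. move n i x y \<in> B} y \<partial>\<eta>)"
      by (rule nn_integral_cong) (simp add: indicator_def)
    moreover have "{y \<in> space \<eta>. move n i x y \<in> B} \<in> sets \<eta>" using B by measurable
    ultimately show ?thesis by (simp add: emeasure_eq_measure)
  qed
qed

section \<open>Growth of the locations in one move\<close>

text \<open>The sum runs over all locations because a detachment shifts the centroid by a multiple
  of its distance from an object, so the centroid alone satisfies no closed estimate.\<close>

definition total_norm :: "nat \<Rightarrow> 'N::finite state \<Rightarrow> real" where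
  "total_norm n x = (\<Sum>j\<le>n. norm (snd x j))"

lemma total_norm_nonneg: "0 \<le> total_norm n x"
  by (simp add: total_norm_def sum_nonneg)

lemma norm_le_total_norm: "j \<le> n \<Longrightarrow> norm (snd x j) \<le> total_norm n x"
  unfolding total_norm_def by (rule member_le_sum) auto

lemma measurable_total_norm[measurable]: "total_norm n \<in> borel_measurable (stateM n :: 'N::finite state measure)"
proof -
  have "(\<lambda>x. norm (snd x j)) \<in> borel_measurable (stateM n :: 'N::finite state measure)" if "j \<in> {..n}" for j
    using measurable_location_stateM[of j n] that by auto
  then show ?thesis unfolding total_norm_def[abs_def] by (rule borel_measurable_sum)
qed

text \<open>At most the locations \<open>i\<close> and \<open>n\<close> change, and the coefficients
  of the shifts are at most one in absolute value, with \<open>1 / 0 = 0\<close> for the last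
  detachment. The factor \<open>3\<close> is generous; with the \<open>2\<close> it gives a
  recursion that a shift makes purely multiplicative.\<close>

lemma total_norm_move_le:
  assumes i: "i < n"
  shows "total_norm n (move n i x y) \<le> 3 * total_norm n x + 2 * norm y"
proof -
  let ?v = "snd x" and ?w = "snd (move n i x y)" and ?k = "card_psi n (fst x)"
  have split: "(\<Sum>j\<le>n. f j) = f n + f i + (\<Sum>j\<in>{..n}-{n,i}. f j)" for f :: "nat \<Rightarrow> real"
    using i by (subst sum.remove[of _ n], simp, simp, subst sum.remove[of _ i])
      (auto simp: Diff_insert2[symmetric] insert_commute)
  have rest: "(\<Sum>j\<in>{..n}-{n,i}. norm (?w j)) = (\<Sum>j\<in>{..n}-{n,i}. norm (?v j))"
    by (intro sum.cong) (auto simp: move_def)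
  have rest0: "0 \<le> (\<Sum>j\<in>{..n}-{n,i}. norm (?v j))" by (simp add: sum_nonneg)
  have sc: "norm (a *\<^sub>R z) \<le> norm z" if "\<bar>a\<bar> \<le> 1" for a and z :: "real^'a"
    using that by (simp add: mult_left_le_one_le)
  have "norm (?w n) + norm (?w i) \<le> 3 * (norm (?v n) + norm (?v i)) + 2 * norm y"
  proof (cases "fst x i")
    case True
    then have "0 < ?k" using card_psi_pos[OF i] by simp
    then have "\<bar>1 / (real ?k - 1)\<bar> \<le> 1" by (cases "?k = 1") auto
    from sc[OF this, of "?v i - ?v n"]
    have "norm (?v n - (1 / (real ?k - 1)) *\<^sub>R (?v i - ?v n)) \<le> norm (?v n) + (norm (?v i) + norm (?v n))"
      by (intro order_trans[OF norm_triangle_ineq4] add_mono) (auto intro: order_trans[OF _ norm_triangle_ineq4])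
    moreover have "?w n = ?v n - (1 / (real ?k - 1)) *\<^sub>R (?v i - ?v n)" "?w i = ?v i"
      using True i by (auto simp: move_def)
    ultimately show ?thesis by (smt (verit) norm_ge_zero)
  next
    case False
    have "norm ((1 / (real ?k + 1)) *\<^sub>R y + ?v n) \<le> norm y + norm (?v n)"
      by (intro order_trans[OF norm_triangle_ineq] add_mono sc) auto
    moreover have "norm (y + ?v n) \<le> norm y + norm (?v n)" by (rule norm_triangle_ineq)
    moreover have "?w n = (1 / (real ?k + 1)) *\<^sub>R y + ?v n" "?w i = y + ?v n"
      using False i by (auto simp: move_def)
    ultimately show ?thesis by (smt (verit) norm_ge_zero)
  qed
  then show ?thesis unfolding total_norm_def split rest using rest0 by (simp add: algebra_simps)
qed

section \<open>The birth-death chain of the number of attached objects\<close>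

definition card_rate :: "real \<Rightarrow> real \<Rightarrow> nat \<Rightarrow> nat \<Rightarrow> real" where
  "card_rate \<theta>a \<theta>d n k = \<theta>d * real k + \<theta>a * (real n - real k)"

text \<open>The jump probabilities of an Ehrenfest urn with unequal rates: every attached object
  detaches at rate \<open>\<theta>d\<close>, every detached one attaches at rate
  \<open>\<theta>a\<close>. The multiplicities \<open>k\<close> and \<open>n - k\<close> rule out
  leaving \<open>{0..n}\<close>.\<close>

definition card_step :: "real \<Rightarrow> real \<Rightarrow> nat \<Rightarrow> nat \<Rightarrow> nat \<Rightarrow> real" where
  "card_step \<theta>a \<theta>d n k l =
     (\<theta>d * real k * of_bool (k = Suc l) + \<theta>a * (real n - real k) * of_bool (l = Suc k)) / card_rate \<theta>a \<theta>d n k"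

lemma rate_fun_eq: "rate_fun \<theta>a \<theta>d n x = card_rate \<theta>a \<theta>d n (card_psi n (fst x))"
  by (simp add: rate_fun_def card_rate_def)

lemma card_rate_pos:
  assumes "0 < \<theta>a" "0 < \<theta>d" "0 < n" "k \<le> n"
  shows "0 < card_rate \<theta>a \<theta>d n k"
proof (cases "k = n")
  case False
  then show ?thesis using assms unfolding card_rate_def
    by (intro add_nonneg_pos mult_pos_pos) auto
qed (use assms in \<open>simp add: card_rate_def\<close>)

lemma card_rate_le:
  assumes "0 < \<theta>a" "0 < \<theta>d" "k \<le> n"
  shows "card_rate \<theta>a \<theta>d n k \<le> (\<theta>a + \<theta>d) * real n"
proof -
  have "\<theta>d * real k \<le> \<theta>d * real n" "\<theta>a * (real n - real k) \<le> \<theta>a * real n"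
    using assms by (auto intro!: mult_left_mono)
  then show ?thesis by (simp add: card_rate_def algebra_simps)
qed

lemma r_i_nonneg:
  assumes "0 < \<theta>a" "0 < \<theta>d"
  shows "0 \<le> r_i \<theta>a \<theta>d n i \<psi>"
  unfolding r_i_def using assms card_psi_le[of n \<psi>]
  by (intro divide_nonneg_nonneg add_nonneg_nonneg mult_nonneg_nonneg) (auto simp: of_bool_def)

text \<open>In each average over the switching object, the contribution of \<open>i\<close> varies
  only among attached objects. The total mass, the law of the new count and the mean of the new
  centroid are all instances.\<close>

lemma sum_r_i_mult_if:
  fixes g :: "nat \<Rightarrow> real"
  shows "(\<Sum>i<n. r_i \<theta>a \<theta>d n i \<psi> * (if \<psi> i then g i else d))
    = (\<theta>d * (\<Sum>i<n. of_bool (\<psi> i) * g i) + \<theta>a * (real n - real (card_psi n \<psi>)) * d)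
       / card_rate \<theta>a \<theta>d n (card_psi n \<psi>)"
proof -
  have "(\<Sum>i<n. r_i \<theta>a \<theta>d n i \<psi> * (if \<psi> i then g i else d))
    = (\<Sum>i<n. (\<theta>d * (of_bool (\<psi> i) * g i) + \<theta>a * (1 - of_bool (\<psi> i)) * d) / card_rate \<theta>a \<theta>d n (card_psi n \<psi>))"
    by (intro sum.cong) (auto simp: r_i_def card_rate_def)
  also have "\<dots> = (\<theta>d * (\<Sum>i<n. of_bool (\<psi> i) * g i) + \<theta>a * (\<Sum>i<n. 1 - of_bool (\<psi> i)) * d) / card_rate \<theta>a \<theta>d n (card_psi n \<psi>)"
    by (simp add: sum_divide_distrib[symmetric] sum.distrib sum_distrib_left sum_distrib_right del: sum_of_bool_mult_eq sum_mult_of_bool_eq)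
  also have "(\<Sum>i<n. 1 - of_bool (\<psi> i)) = real n - real (card_psi n \<psi>)"
    by (simp only: sum_subtractf sum_of_bool_psi) simp
  finally show ?thesis .
qed

lemma sum_r_i:
  assumes "0 < \<theta>a" "0 < \<theta>d" "0 < n"
  shows "(\<Sum>i<n. r_i \<theta>a \<theta>d n i \<psi>) = 1"
proof -
  have "(\<Sum>i<n. r_i \<theta>a \<theta>d n i \<psi>) = (\<Sum>i<n. r_i \<theta>a \<theta>d n i \<psi> * (if \<psi> i then 1 else 1))" by simp
  also have "\<dots> = 1"
    unfolding sum_r_i_mult_if using card_rate_pos[OF assms card_psi_le, of \<psi>]
    by (simp only: mult_1_right sum_of_bool_psi) (simp add: card_rate_def)
  finally show ?thesis .
qed

text \<open>Lumpability: the right-hand side sees \<open>\<psi>\<close> only through its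
  cardinality, so the counts form a Markov chain by themselves.\<close>

lemma sum_r_i_card_step:
  "(\<Sum>i<n. r_i \<theta>a \<theta>d n i \<psi> * of_bool (card_psi n (s_i i \<psi>) = l)) = card_step \<theta>a \<theta>d n (card_psi n \<psi>) l"
proof -
  let ?k = "card_psi n \<psi>"
  have "(\<Sum>i<n. r_i \<theta>a \<theta>d n i \<psi> * of_bool (card_psi n (s_i i \<psi>) = l))
     = (\<Sum>i<n. r_i \<theta>a \<theta>d n i \<psi> * (if \<psi> i then of_bool (?k = Suc l) else of_bool (l = Suc ?k)))"
  proof (intro sum.cong refl)
    fix i assume "i \<in> {..<n}"
    then have i: "i < n" by simp
    show "r_i \<theta>a \<theta>d n i \<psi> * of_bool (card_psi n (s_i i \<psi>) = l)
        = r_i \<theta>a \<theta>d n i \<psi> * (if \<psi> i then of_bool (?k = Suc l) else of_bool (l = Suc ?k))"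
      using card_psi_pos[OF i, of \<psi>] by (auto simp: card_psi_s_i[OF i])
  qed
  also have "\<dots> = card_step \<theta>a \<theta>d n ?k l"
    unfolding sum_r_i_mult_if sum_distrib_right[symmetric] sum_of_bool_psi card_step_def by simp
  finally show ?thesis .
qed

text \<open>The detachment shifts share the factor \<open>- (1 / (k - 1))\<close>, which comes out
  of the sum over the attached objects; what remains is the balance that defines
  \<open>Xset\<close>. With \<open>1 / 0 = 0\<close> this covers \<open>k = 1\<close> too.\<close>

lemma sum_r_i_centroid:
  fixes \<eta> :: "(real^'N::finite) measure"
  assumes pos: "0 < \<theta>a" "0 < \<theta>d" "0 < n" and "prob_space \<eta>" and int: "integrable \<eta> (\<lambda>y. y $ b)"
    and x: "x \<in> Xset n"
  shows "(\<Sum>i<n. r_i \<theta>a \<theta>d n i (fst x) * (\<integral>y. snd (move n i x y) n $ b \<partial>\<eta>))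
     = snd x n $ b + \<theta>a * (real n - real (card_psi n (fst x))) / (real (card_psi n (fst x)) + 1)
         / card_rate \<theta>a \<theta>d n (card_psi n (fst x)) * (\<integral>y. y $ b \<partial>\<eta>)"
proof -
  interpret prob_space \<eta> by fact
  obtain \<psi> v where x_eq: "x = (\<psi>, v)" by (cases x)
  let ?k = "card_psi n \<psi>" and ?e = "\<integral>y. y $ b \<partial>\<eta>"
  have "(\<Sum>i<n. of_bool (\<psi> i) *\<^sub>R (v i - v n)) $ b = 0"
    using x by (simp add: Xset_def x_eq)
  then have bal: "(\<Sum>i<n. of_bool (\<psi> i) * (v i $ b - v n $ b)) = 0"
    by (simp only: sum_component vector_scaleR_component vector_minus_component) simp
  have term_eq: "(\<integral>y. snd (move n i x y) n $ b \<partial>\<eta>) = v n $ b +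
     (if \<psi> i then - (1 / (real ?k - 1)) * (v i $ b - v n $ b) else 1 / (real ?k + 1) * ?e)" for i
    using int by (simp add: move_def x_eq prob_space)
  have "(\<Sum>i<n. r_i \<theta>a \<theta>d n i \<psi> * (\<integral>y. snd (move n i x y) n $ b \<partial>\<eta>))
     = v n $ b * (\<Sum>i<n. r_i \<theta>a \<theta>d n i \<psi>) + (\<Sum>i<n. r_i \<theta>a \<theta>d n i \<psi> *
      (if \<psi> i then - (1 / (real ?k - 1)) * (v i $ b - v n $ b) else 1 / (real ?k + 1) * ?e))"
    unfolding term_eq sum_distrib_left sum.distrib[symmetric]
    by (intro sum.cong refl) (simp only: distrib_left mult.commute)
  also have "(\<Sum>i<n. of_bool (\<psi> i) * (- (1 / (real ?k - 1)) * (v i $ b - v n $ b)))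
      = - (1 / (real ?k - 1)) * (\<Sum>i<n. of_bool (\<psi> i) * (v i $ b - v n $ b))"
    unfolding sum_distrib_left by (intro sum.cong refl) (simp only: mult_ac)
  then have "(\<Sum>i<n. r_i \<theta>a \<theta>d n i \<psi> *
      (if \<psi> i then - (1 / (real ?k - 1)) * (v i $ b - v n $ b) else 1 / (real ?k + 1) * ?e))
      = \<theta>a * (real n - real ?k) / (real ?k + 1) / card_rate \<theta>a \<theta>d n ?k * ?e"
    unfolding sum_r_i_mult_if bal by simp
  finally show ?thesis using sum_r_i[OF pos] by (simp add: x_eq)
qed

lemma sum_card_step:
  assumes "0 < \<theta>a" "0 < \<theta>d" "0 < n" "k \<le> n"
  shows "(\<Sum>l\<le>n. card_step \<theta>a \<theta>d n k l) = 1"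
proof -
  \<comment> \<open>The factor \<open>real k\<close> is kept because for \<open>k = 0\<close> no
    \<open>l\<close> matches and the sum alone is not \<open>1\<close>;
    \<open>real n - real k\<close> does the same for \<open>k = n\<close> in the second
    fact.\<close>
  have 1: "(\<Sum>l\<le>n. of_bool (k = Suc l)) * real k = real k"
  proof (cases k)
    case (Suc k')
    then have "(\<Sum>l\<le>n. of_bool (k = Suc l)) = (\<Sum>l\<le>n. if l = k' then 1 else 0 :: real)"
      by (intro sum.cong) auto
    then show ?thesis using Suc assms by simp
  qed simp
  have 2: "(\<Sum>l\<le>n. of_bool (l = Suc k)) * (real n - real k) = real n - real k"
  proof (cases "k = n")
    case False
    have "(\<Sum>l\<le>n. of_bool (l = Suc k)) = (\<Sum>l\<le>n. if l = Suc k then 1 else 0 :: real)"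
      by (intro sum.cong) auto
    then show ?thesis using False assms by simp
  qed simp
  have "(\<Sum>l\<le>n. card_step \<theta>a \<theta>d n k l) =
     (\<theta>d * ((\<Sum>l\<le>n. of_bool (k = Suc l)) * real k) + \<theta>a * ((\<Sum>l\<le>n. of_bool (l = Suc k)) * (real n - real k)))
       / card_rate \<theta>a \<theta>d n k"
    unfolding card_step_def sum_divide_distrib[symmetric] sum_distrib_right sum_distrib_left sum.distrib[symmetric]
    by (intro arg_cong2[where f="(/)"] sum.cong refl) (simp only: mult_ac)
  also have "\<dots> = 1"
    unfolding 1 2 using card_rate_pos[OF assms] by (simp add: card_rate_def)
  finally show ?thesis .
qed

text \<open>Detailed balance. It rests on
  \<open>(k + 1) * (n choose (k + 1)) = (n - k) * (n choose k)\<close>: both sides count sets of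
  size \<open>k + 1\<close> with one marked element.\<close>

lemma sigma_w_balance:
  assumes "0 < \<theta>a" "0 < \<theta>d" "k < n"
  shows "sigma_w \<theta>a \<theta>d n (Suc k) * (\<theta>d * real (Suc k)) = sigma_w \<theta>a \<theta>d n k * (\<theta>a * (real n - real k))"
proof -
  have "Suc k * (n choose Suc k) = (n - k) * (n choose k)"
    using binomial_absorption[of k n] binomial_absorb_comp[of n k] by simp
  then have b: "real (Suc k) * real (n choose Suc k) = (real n - real k) * real (n choose k)"
    using assms by (metis of_nat_diff of_nat_mult less_imp_le)
  have e: "\<theta>d ^ (n - k) = \<theta>d * \<theta>d ^ (n - Suc k)"
    using assms by (simp add: Suc_diff_Suc flip: power_Suc)
  have "real (n choose Suc k) * \<theta>d ^ (n - Suc k) * \<theta>a ^ Suc k * (\<theta>d * real (Suc k))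
     = (real (Suc k) * real (n choose Suc k)) * (\<theta>d * \<theta>d ^ (n - Suc k)) * \<theta>a ^ k * \<theta>a"
    by (simp add: mult_ac del: of_nat_Suc)
  also have "\<dots> = real (n choose k) * \<theta>d ^ (n - k) * \<theta>a ^ k * (\<theta>a * (real n - real k))"
    unfolding b e by (simp add: mult_ac)
  finally show ?thesis
    using assms by (simp add: sigma_w_def del: of_nat_Suc power_Suc)
qed

lemma sum_sigma_w:
  assumes "0 < \<theta>a" "0 < \<theta>d"
  shows "(\<Sum>k\<le>n. sigma_w \<theta>a \<theta>d n k) = 1"
proof -
  have "(\<Sum>k\<le>n. sigma_w \<theta>a \<theta>d n k) = (\<Sum>k\<le>n. real (n choose k) * \<theta>a ^ k * \<theta>d ^ (n - k)) / (\<theta>d + \<theta>a) ^ n"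
    unfolding sum_divide_distrib by (intro sum.cong) (auto simp: sigma_w_def mult_ac)
  also have "\<dots> = 1"
    unfolding binomial_ring[symmetric] using assms by (simp add: add.commute)
  finally show ?thesis .
qed

text \<open>Stationarity in continuous time, hence the rates on both sides: the jump chain alone has
  invariant weights proportional to rate times \<open>sigma_w\<close>. Detailed balance exchanges
  the inflow from each neighbour for the outflow towards it.\<close>

lemma sigma_w_stationary:
  assumes pos: "0 < \<theta>a" "0 < \<theta>d" "0 < n" and l: "l \<le> n"
  shows "(\<Sum>k\<le>n. sigma_w \<theta>a \<theta>d n k * card_rate \<theta>a \<theta>d n k * card_step \<theta>a \<theta>d n k l)
     = card_rate \<theta>a \<theta>d n l * sigma_w \<theta>a \<theta>d n l"
proof -
  let ?\<sigma> = "sigma_w \<theta>a \<theta>d n"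
  have "(\<Sum>k\<le>n. ?\<sigma> k * card_rate \<theta>a \<theta>d n k * card_step \<theta>a \<theta>d n k l)
     = (\<Sum>k\<le>n. (if k = Suc l then ?\<sigma> k * (\<theta>d * real k) else 0)
          + (if l = Suc k then ?\<sigma> k * (\<theta>a * (real n - real k)) else 0))"
  proof (intro sum.cong refl)
    fix k assume "k \<in> {..n}"
    then have "card_rate \<theta>a \<theta>d n k \<noteq> 0" using card_rate_pos[OF pos, of k] by simp
    then show "?\<sigma> k * card_rate \<theta>a \<theta>d n k * card_step \<theta>a \<theta>d n k l
      = (if k = Suc l then ?\<sigma> k * (\<theta>d * real k) else 0)
          + (if l = Suc k then ?\<sigma> k * (\<theta>a * (real n - real k)) else 0)"
      by (simp add: card_step_def)
  qed
  also have "\<dots> = ?\<sigma> l * (\<theta>a * (real n - real l)) + ?\<sigma> l * (\<theta>d * real l)"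
    unfolding sum.distrib
  proof (intro arg_cong2[where f="(+)"])
    show "(\<Sum>k\<le>n. if k = Suc l then ?\<sigma> k * (\<theta>d * real k) else 0) = ?\<sigma> l * (\<theta>a * (real n - real l))"
      using l sigma_w_balance[OF pos(1,2), of l n] by (cases "l = n") (auto simp del: of_nat_Suc)
    show "(\<Sum>k\<le>n. if l = Suc k then ?\<sigma> k * (\<theta>a * (real n - real k)) else 0) = ?\<sigma> l * (\<theta>d * real l)"
    proof (cases l)
      case (Suc k')
      then have "(\<Sum>k\<le>n. if l = Suc k then ?\<sigma> k * (\<theta>a * (real n - real k)) else 0)
         = (\<Sum>k\<le>n. if k = k' then ?\<sigma> k * (\<theta>a * (real n - real k)) else 0)"
        by (intro sum.cong) auto
      then show ?thesis using Suc l sigma_w_balance[OF pos(1,2), of k' n] by (simp del: of_nat_Suc)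
    qed simp
  qed
  finally show ?thesis by (simp add: card_rate_def algebra_simps)
qed

text \<open>The denominator \<open>k + 1\<close> of the drift cancels the number of objects that can
  detach from count \<open>k + 1\<close>, so balance turns each term with \<open>k < n\<close> into
  \<open>\<theta>d\<close> times the weight of \<open>k + 1\<close>; only the weight of
  \<open>0\<close> is missing from the total mass.\<close>

lemma sum_drift_sigma_w:
  assumes pos: "0 < \<theta>a" "0 < \<theta>d"
  shows "(\<Sum>k\<le>n. \<theta>a * (real n - real k) / (real k + 1) * sigma_w \<theta>a \<theta>d n k)
     = \<theta>d / (\<theta>d + \<theta>a) ^ n * ((\<theta>d + \<theta>a) ^ n - \<theta>d ^ n)"
proof -
  let ?\<sigma> = "sigma_w \<theta>a \<theta>d n"
  have "(\<Sum>k\<le>n. \<theta>a * (real n - real k) / (real k + 1) * ?\<sigma> k) = (\<Sum>k<n. \<theta>a * (real n - real k) / (real k + 1) * ?\<sigma> k)"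
    by (simp add: lessThan_Suc_atMost[symmetric])
  also have "\<dots> = (\<Sum>k<n. \<theta>d * ?\<sigma> (Suc k))"
  proof (intro sum.cong refl)
    fix k assume "k \<in> {..<n}"
    then show "\<theta>a * (real n - real k) / (real k + 1) * ?\<sigma> k = \<theta>d * ?\<sigma> (Suc k)"
      using sigma_w_balance[OF pos, of k n] by (simp add: divide_simps) (simp add: algebra_simps)
  qed
  also have "\<dots> = \<theta>d * ((\<Sum>k<Suc n. ?\<sigma> k) - ?\<sigma> 0)"
    by (simp only: sum.lessThan_Suc_shift sum_distrib_left[symmetric]) simp
  also have "\<dots> = \<theta>d * (1 - \<theta>d ^ n / (\<theta>d + \<theta>a) ^ n)"
    unfolding lessThan_Suc_atMost sum_sigma_w[OF pos] by (simp add: sigma_w_def)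
  also have "\<dots> = \<theta>d / (\<theta>d + \<theta>a) ^ n * ((\<theta>d + \<theta>a) ^ n - \<theta>d ^ n)"
    using pos by (simp add: field_simps)
  finally show ?thesis .
qed

section \<open>The process\<close>

text \<open>Replaces the random index chosen by \<open>LEAST\<close> in \<open>Xproc\<close> by a
  sum over all fixed indices in which just one term survives.\<close>

lemma LEAST_level_crossing:
  fixes f :: "nat \<Rightarrow> real"
  assumes inc: "\<And>k. f k < f (Suc k)" and "f 0 \<le> s" and "\<exists>k. s < f k"
  defines "N \<equiv> LEAST k. f k \<le> s \<and> s < f (Suc k)"
  shows "indicator {..s} (f k) - indicator {..s} (f (Suc k)) = (if k = N then 1 else 0 :: real)"
proof -
  have mono: "strict_mono f" by (rule strict_monoI_Suc) (rule inc)
  define m where "m = (LEAST m. s < f m)"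
  have m: "s < f m" unfolding m_def using assms(3) by (rule LeastI_ex)
  then have "m \<noteq> 0" using assms(2) by (metis not_less)
  then obtain m' where m': "m = Suc m'" by (cases m) auto
  have "\<not> s < f m'" using not_less_Least[of m' "\<lambda>m. s < f m"] m' by (simp add: m_def)
  then have "\<exists>k. f k \<le> s \<and> s < f (Suc k)" using m m' by (auto intro!: exI[of _ m'])
  then have N: "f N \<le> s" "s < f (Suc N)" unfolding N_def by (metis (mono_tags, lifting) LeastI_ex)+
  consider "k < N" | "k = N" | "N < k" by linarith
  then show ?thesis
  proof cases
    case 1
    then have "f k \<le> f N" "f (Suc k) \<le> f N" using strict_mono_less_eq[OF mono] by auto
    then show ?thesis using 1 N by (simp add: indicator_def)
  next
    case 3
    then have "f (Suc N) \<le> f k" "f (Suc N) \<le> f (Suc k)" using strict_mono_less_eq[OF mono] by auto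
    then show ?thesis using 3 N by (simp add: indicator_def)
  qed (use N in simp)
qed

text \<open>Preimages under a composition are again preimages under the inner map, and families of
  preimages are closed under intersection, so independence extends to the sigma-algebras that
  \<open>indep_var\<close> speaks of.\<close>

lemma (in prob_space) indep_var_of_indep_set:
  assumes ind: "indep_set {X -` A \<inter> space M | A. A \<in> sets N} {X' -` A \<inter> space M | A. A \<in> sets N'}"
    and X[measurable]: "X \<in> M \<rightarrow>\<^sub>M N" and X'[measurable]: "X' \<in> M \<rightarrow>\<^sub>M N'"
    and f[measurable]: "f \<in> N \<rightarrow>\<^sub>M L" and f'[measurable]: "f' \<in> N' \<rightarrow>\<^sub>M L'"
  shows "indep_var L (\<lambda>\<omega>. f (X \<omega>)) L' (\<lambda>\<omega>. f' (X' \<omega>))"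
proof -
  have Int_stable: "Int_stable {V -` A \<inter> space M | A. A \<in> sets K}" for V :: "'a \<Rightarrow> 'z" and K
  proof (safe intro!: Int_stableI)
    fix A B assume "A \<in> sets K" "B \<in> sets K"
    then show "\<exists>D. V -` A \<inter> space M \<inter> (V -` B \<inter> space M) = V -` D \<inter> space M \<and> D \<in> sets K"
      by (intro exI[of _ "A \<inter> B"]) auto
  qed
  have sub: "{(\<lambda>\<omega>. g (V \<omega>)) -` A \<inter> space M | A. A \<in> sets K} \<subseteq> {V -` A \<inter> space M | A. A \<in> sets K'}"
    if "V \<in> M \<rightarrow>\<^sub>M K'" "g \<in> K' \<rightarrow>\<^sub>M K" for V :: "'a \<Rightarrow> 'y" and g :: "'y \<Rightarrow> 'z" and K K'
  proof safe
    fix A assume "A \<in> sets K"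
    then have "g -` A \<inter> space K' \<in> sets K'" using that by (intro measurable_sets)
    moreover have "(\<lambda>\<omega>. g (V \<omega>)) -` A \<inter> space M = V -` (g -` A \<inter> space K') \<inter> space M"
      using measurable_space[OF that(1)] by auto
    ultimately show "\<exists>D. (\<lambda>\<omega>. g (V \<omega>)) -` A \<inter> space M = V -` D \<inter> space M \<and> D \<in> sets K'" by blast
  qed
  have "indep_set {(\<lambda>\<omega>. f (X \<omega>)) -` A \<inter> space M | A. A \<in> sets L} {(\<lambda>\<omega>. f' (X' \<omega>)) -` A \<inter> space M | A. A \<in> sets L'}"
    unfolding indep_set_def
  proof (rule indep_sets_mono_sets[OF ind[unfolded indep_set_def]])
    fix b :: bool
    show "(case b of True \<Rightarrow> {(\<lambda>\<omega>. f (X \<omega>)) -` A \<inter> space M | A. A \<in> sets L}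
        | False \<Rightarrow> {(\<lambda>\<omega>. f' (X' \<omega>)) -` A \<inter> space M | A. A \<in> sets L'})
      \<subseteq> (case b of True \<Rightarrow> {X -` A \<inter> space M | A. A \<in> sets N} | False \<Rightarrow> {X' -` A \<inter> space M | A. A \<in> sets N'})"
      using sub[OF X f] sub[OF X' f'] by (cases b) simp_all
  qed
  then have "indep_set (sigma_sets (space M) {(\<lambda>\<omega>. f (X \<omega>)) -` A \<inter> space M | A. A \<in> sets L})
      (sigma_sets (space M) {(\<lambda>\<omega>. f' (X' \<omega>)) -` A \<inter> space M | A. A \<in> sets L'})"
    by (intro indep_set_sigma_sets Int_stable)
  then show ?thesis unfolding indep_var_eq by simp
qed

definition kernel_mean ::
    "real \<Rightarrow> real \<Rightarrow> (real^'N::finite) measure \<Rightarrow> nat \<Rightarrow> ('N state \<Rightarrow> real) \<Rightarrow> 'N state \<Rightarrow> real" where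
  "kernel_mean \<theta>a \<theta>d \<eta> n F x = (\<Sum>i<n. r_i \<theta>a \<theta>d n i (fst x) * (\<integral>y. F (move n i x y) \<partial>\<eta>))"

locale attachment_process = prob_space M
  for M :: "'w measure" +
  fixes \<theta>a \<theta>d R :: real and n :: nat
    and \<eta> :: "(real^'N::finite) measure" and \<rho> :: "'N state measure"
    and Y :: "nat \<Rightarrow> 'w \<Rightarrow> 'N state" and \<gamma> :: "nat \<Rightarrow> 'w \<Rightarrow> real"
  assumes pos: "0 < \<theta>a" "0 < \<theta>d" "0 < n" "0 < R"
    and prob_\<eta>: "prob_space \<eta>" and sets_\<eta>: "sets \<eta> = sets borel"
    and bounded_\<eta>: "AE x in \<eta>. \<forall>i. \<bar>x $ i\<bar> \<le> R"
    and sets_\<rho>: "sets \<rho> = sets (stateM n)"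
    and card_\<rho>: "distr \<rho> (count_space UNIV) (\<lambda>x. card_psi n (fst x))
           = density (count_space UNIV) (\<lambda>k. ennreal (sigma_w \<theta>a \<theta>d n k))"
    and integrable_\<rho>: "\<forall>i\<le>n. integrable \<rho> (\<lambda>x. snd x i)"
    and measurable_Y: "\<forall>k. Y k \<in> measurable M (stateM n)"
    and distr_Y_0: "distr M (stateM n) (Y 0) = \<rho>"
    and markov: "\<forall>k B. (\<forall>j. B j \<in> sets (stateM n)) \<longrightarrow>
           measure M {\<omega> \<in> space M. \<forall>j\<le>Suc k. Y j \<omega> \<in> B j}
           = (\<integral>\<omega>. indicator {\<omega> \<in> space M. \<forall>j\<le>k. Y j \<omega> \<in> B j} \<omega>
                    * jump_kernel \<theta>a \<theta>d \<eta> n (Y k \<omega>) (B (Suc k)) \<partial>M)"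
    and exponential_\<gamma>: "\<forall>k\<ge>1. distributed M lborel (\<gamma> k) (exponential_density 1)"
    and indep_\<gamma>: "indep_vars (\<lambda>_. borel) \<gamma> {1..}"
    and indep_Y_\<gamma>: "indep_set
           {(\<lambda>\<omega> k. Y k \<omega>) -` A \<inter> space M | A. A \<in> sets (PiM UNIV (\<lambda>_. stateM n))}
           {(\<lambda>\<omega>. restrict (\<lambda>k. \<gamma> k \<omega>) {1..}) -` A \<inter> space M | A.
               A \<in> sets (PiM {1..} (\<lambda>_. (borel :: real measure)))}"
begin

lemma rv_Y[measurable]: "Y k \<in> M \<rightarrow>\<^sub>M stateM n"
  using measurable_Y by simp

lemma rv_\<gamma>: "1 \<le> k \<Longrightarrow> \<gamma> k \<in> borel_measurable M"
  using distributed_measurable[of M lborel "\<gamma> k"] exponential_\<gamma> by fastforce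

lemma Y_in_Xset: "\<omega> \<in> space M \<Longrightarrow> Y k \<omega> \<in> Xset n"
  using measurable_space[OF rv_Y] by (simp add: space_stateM)

lemmas \<eta>_cong[measurable_cong] = sets_\<eta>

definition J :: "nat \<Rightarrow> 'w \<Rightarrow> nat" where
  "J k \<omega> = card_psi n (fst (Y k \<omega>))"

lemma rv_J[measurable]: "J k \<in> M \<rightarrow>\<^sub>M count_space UNIV"
  unfolding J_def[abs_def] by (rule measurable_compose[OF rv_Y measurable_card_psi])

lemma J_le: "J k \<omega> \<le> n"
  by (simp add: J_def card_psi_le)

abbreviation (input) "c \<equiv> card_rate \<theta>a \<theta>d n"
abbreviation (input) "\<sigma> \<equiv> sigma_w \<theta>a \<theta>d n"
abbreviation (input) "r \<equiv> r_i \<theta>a \<theta>d n"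
abbreviation (input) "\<K> \<equiv> kernel_mean \<theta>a \<theta>d \<eta> n"

lemma c_pos: "k \<le> n \<Longrightarrow> 0 < c k"
  using card_rate_pos pos by simp

lemma r_nonneg: "0 \<le> r i \<psi>"
  using r_i_nonneg pos by simp

lemma borel_measurable_r_i_Y[measurable]: "i < n \<Longrightarrow> (\<lambda>\<omega>. r i (fst (Y k \<omega>))) \<in> borel_measurable M"
  by (rule measurable_compose[OF rv_Y measurable_r_i])

section \<open>One step of the chain\<close>

definition history :: "nat \<Rightarrow> (nat \<Rightarrow> 'N state set) \<Rightarrow> 'w set" where
  "history k B = {\<omega> \<in> space M. \<forall>j\<le>k. Y j \<omega> \<in> B j}"

text \<open>One step of the chain uses the past, the index of the switching object and its displacement if it attaches;
  the Markov assumption says that the next state is the image of their weighted joint law.\<close>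

definition choice_space :: "(nat \<times> 'w \<times> (real^'N)) measure" where
  "choice_space = count_space {..<n} \<Otimes>\<^sub>M (M \<Otimes>\<^sub>M \<eta>)"

definition choice_weight :: "nat \<Rightarrow> 'w set \<Rightarrow> nat \<times> 'w \<times> (real^'N) \<Rightarrow> real" where
  "choice_weight k C = (\<lambda>(i, \<omega>, y). indicator C \<omega> * r i (fst (Y k \<omega>)))"

definition choice_move :: "nat \<Rightarrow> nat \<times> 'w \<times> (real^'N) \<Rightarrow> 'N state" where
  "choice_move k = (\<lambda>(i, \<omega>, y). move n i (Y k \<omega>) y)"

lemma sets_history:
  assumes "\<And>j. B j \<in> sets (stateM n)"
  shows "history k B \<in> sets M"
proof -
  have "history k B = (\<Inter>j\<in>{..k}. Y j -` B j \<inter> space M)" by (auto simp: history_def)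
  then show ?thesis using assms by (auto intro!: sets.finite_INT measurable_sets[OF rv_Y])
qed

lemma measurable_choice_move[measurable]: "choice_move k \<in> choice_space \<rightarrow>\<^sub>M stateM n"
  unfolding choice_move_def choice_space_def
proof (rule measurable_pair_measure_countable1)
  fix i assume "i \<in> {..<n}"
  then have i: "i < n" by simp
  show "(\<lambda>y. case (i, y) of (i, \<omega>, y) \<Rightarrow> move n i (Y k \<omega>) y) \<in> M \<Otimes>\<^sub>M \<eta> \<rightarrow>\<^sub>M stateM n"
    using i by simp
qed simp

lemma measurable_choice_weight[measurable]:
  assumes [measurable]: "C \<in> sets M"
  shows "choice_weight k C \<in> borel_measurable choice_space"
  unfolding choice_weight_def choice_space_def
proof (rule measurable_pair_measure_countable1)
  fix i assume "i \<in> {..<n}"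
  then have [measurable]: "(\<lambda>\<omega>. r i (fst (Y k \<omega>))) \<in> borel_measurable M" by (intro borel_measurable_r_i_Y) auto
  show "(\<lambda>y. case (i, y) of (i, \<omega>, y) \<Rightarrow> indicator C \<omega> * r i (fst (Y k \<omega>))) \<in> borel_measurable (M \<Otimes>\<^sub>M \<eta>)"
    by simp
qed simp

lemma choice_weight_nonneg: "0 \<le> choice_weight k C q"
  by (auto simp: choice_weight_def r_nonneg split: prod.split)

lemma nn_integral_choice_space:
  assumes f: "f \<in> borel_measurable choice_space"
  shows "(\<integral>\<^sup>+q. f q \<partial>choice_space) = (\<Sum>i<n. \<integral>\<^sup>+\<omega>. \<integral>\<^sup>+y. f (i, \<omega>, y) \<partial>\<eta> \<partial>M)"
proof -
  interpret E: prob_space \<eta> by (rule prob_\<eta>)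
  interpret ME: pair_prob_space M \<eta> ..
  have "(\<integral>\<^sup>+q. f q \<partial>choice_space) = (\<integral>\<^sup>+i. \<integral>\<^sup>+p. f (i, p) \<partial>(M \<Otimes>\<^sub>M \<eta>) \<partial>count_space {..<n})"
    using f unfolding choice_space_def by (intro ME.P.nn_integral_fst[symmetric])
  also have "\<dots> = (\<Sum>i<n. \<integral>\<^sup>+p. f (i, p) \<partial>(M \<Otimes>\<^sub>M \<eta>))"
    by (simp add: nn_integral_count_space_finite)
  also have "\<dots> = (\<Sum>i<n. \<integral>\<^sup>+\<omega>. \<integral>\<^sup>+y. f (i, \<omega>, y) \<partial>\<eta> \<partial>M)"
  proof (intro sum.cong refl E.nn_integral_fst[symmetric])
    fix i assume "i \<in> {..<n}"
    then show "(\<lambda>p. f (i, p)) \<in> borel_measurable (M \<Otimes>\<^sub>M \<eta>)"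
      using f unfolding choice_space_def by (intro measurable_compose[OF measurable_Pair1' f[unfolded choice_space_def]]) simp
  qed
  finally show ?thesis .
qed

lemma integral_choice_space:
  fixes f :: "nat \<times> 'w \<times> (real^'N) \<Rightarrow> real"
  assumes f: "integrable choice_space f"
  shows "(\<integral>q. f q \<partial>choice_space) = (\<integral>\<omega>. (\<Sum>i<n. \<integral>y. f (i, \<omega>, y) \<partial>\<eta>) \<partial>M)"
proof -
  interpret E: prob_space \<eta> by (rule prob_\<eta>)
  interpret ME: pair_prob_space M \<eta> ..
  interpret CS: sigma_finite_measure "count_space {..<n}" by (rule sigma_finite_measure_count_space_finite) simp
  interpret P: pair_sigma_finite "count_space {..<n}" "M \<Otimes>\<^sub>M \<eta>" ..
  have meas: "(\<lambda>p. f (i, p)) \<in> borel_measurable (M \<Otimes>\<^sub>M \<eta>)" if "i < n" for i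
    using f that unfolding choice_space_def
    by (intro measurable_compose[OF measurable_Pair1' borel_measurable_integrable[OF f[unfolded choice_space_def]]]) simp
  have int: "integrable (M \<Otimes>\<^sub>M \<eta>) (\<lambda>p. f (i, p))" if "i < n" for i
    using P.AE_integrable_fst'[OF f[unfolded choice_space_def]] that by (simp add: AE_count_space)
  have "(\<integral>q. f q \<partial>choice_space) = (\<integral>i. \<integral>p. f (i, p) \<partial>(M \<Otimes>\<^sub>M \<eta>) \<partial>count_space {..<n})"
    using f unfolding choice_space_def by (intro P.integral_fst'[symmetric])
  also have "\<dots> = (\<Sum>i<n. \<integral>p. f (i, p) \<partial>(M \<Otimes>\<^sub>M \<eta>))"
    by (simp add: lebesgue_integral_count_space_finite)
  also have "\<dots> = (\<Sum>i<n. \<integral>\<omega>. \<integral>y. f (i, \<omega>, y) \<partial>\<eta> \<partial>M)"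
    by (intro sum.cong refl ME.integral_fst'[symmetric] int) simp
  also have "\<dots> = (\<integral>\<omega>. (\<Sum>i<n. \<integral>y. f (i, \<omega>, y) \<partial>\<eta>) \<partial>M)"
    by (intro Bochner_Integration.integral_sum[symmetric] ME.integrable_fst'[OF int]) simp
  finally show ?thesis .
qed

lemma lam_i_nonneg: "0 \<le> lam_i \<eta> n i x B"
  by (simp add: lam_i_def Let_def)

lemma lam_i_le_1: "lam_i \<eta> n i x B \<le> 1"
proof -
  interpret E: prob_space \<eta> by (rule prob_\<eta>)
  show ?thesis by (simp add: lam_i_def Let_def indicator_def)
qed

text \<open>The Markov assumption, tested on \<open>A\<close> as the new last condition, combined
  with \<open>lam_i_eq_nn_integral\<close> and Tonelli. An identity of measures, unlike one of
  probabilities, can be integrated against unbounded functions such as the locations.\<close>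

lemma distr_next_state:
  assumes B: "\<And>j. B j \<in> sets (stateM n)"
  shows "distr (density M (\<lambda>\<omega>. ennreal (indicator (history k B) \<omega>))) (stateM n) (Y (Suc k))
    = distr (density choice_space (\<lambda>q. ennreal (choice_weight k (history k B) q))) (stateM n) (choice_move k)"
proof (rule measure_eqI)
  interpret E: prob_space \<eta> by (rule prob_\<eta>)
  let ?C = "history k B"
  have C[measurable]: "?C \<in> sets M" using B by (rule sets_history)
  fix A assume "A \<in> sets (distr (density M (\<lambda>\<omega>. ennreal (indicator ?C \<omega>))) (stateM n) (Y (Suc k)))"
  then have A[measurable]: "A \<in> sets (stateM n)" by simp
  let ?B = "\<lambda>j. if j = Suc k then A else B j"
  have "measure M {\<omega> \<in> space M. \<forall>j\<le>Suc k. Y j \<omega> \<in> ?B j}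
           = (\<integral>\<omega>. indicator {\<omega> \<in> space M. \<forall>j\<le>k. Y j \<omega> \<in> ?B j} \<omega>
                    * jump_kernel \<theta>a \<theta>d \<eta> n (Y k \<omega>) (?B (Suc k)) \<partial>M)"
    using A B by (intro markov[rule_format]) auto
  moreover have "{\<omega> \<in> space M. \<forall>j\<le>Suc k. Y j \<omega> \<in> ?B j} = {\<omega> \<in> space M. \<omega> \<in> ?C \<and> Y (Suc k) \<omega> \<in> A}"
    by (auto simp: history_def le_Suc_eq)
  moreover have "{\<omega> \<in> space M. \<forall>j\<le>k. Y j \<omega> \<in> ?B j} = ?C"
    by (auto simp: history_def)
  ultimately have mk: "measure M {\<omega> \<in> space M. \<omega> \<in> ?C \<and> Y (Suc k) \<omega> \<in> A}
      = (\<integral>\<omega>. indicator ?C \<omega> * jump_kernel \<theta>a \<theta>d \<eta> n (Y k \<omega>) A \<partial>M)" by simp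
  have lam: "ennreal (lam_i \<eta> n i (Y k \<omega>) A) = (\<integral>\<^sup>+y. indicator A (move n i (Y k \<omega>) y) \<partial>\<eta>)"
    if "\<omega> \<in> space M" "i < n" for i \<omega>
    using that by (intro lam_i_eq_nn_integral prob_\<eta> sets_\<eta> Y_in_Xset A)
  have lam_meas[measurable]: "(\<lambda>\<omega>. lam_i \<eta> n i (Y k \<omega>) A) \<in> borel_measurable M" if i: "i < n" for i
  proof -
    have "(\<lambda>\<omega>. \<integral>\<^sup>+y. indicator A (move n i (Y k \<omega>) y) \<partial>\<eta>) \<in> borel_measurable M"
      using i by measurable
    then have "(\<lambda>\<omega>. enn2real (\<integral>\<^sup>+y. indicator A (move n i (Y k \<omega>) y) \<partial>\<eta>)) \<in> borel_measurable M"
      by measurable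
    moreover have "lam_i \<eta> n i (Y k \<omega>) A = enn2real (\<integral>\<^sup>+y. indicator A (move n i (Y k \<omega>) y) \<partial>\<eta>)" if "\<omega> \<in> space M" for \<omega>
      unfolding lam[OF that i, symmetric] by (simp add: lam_i_nonneg)
    ultimately show ?thesis by (simp cong: measurable_cong)
  qed
  have jk_meas: "(\<lambda>\<omega>. jump_kernel \<theta>a \<theta>d \<eta> n (Y k \<omega>) A) \<in> borel_measurable M"
    unfolding jump_kernel_def by (intro borel_measurable_sum borel_measurable_times lam_meas borel_measurable_r_i_Y) auto
  have jk_nonneg: "0 \<le> jump_kernel \<theta>a \<theta>d \<eta> n x A" for x
    unfolding jump_kernel_def by (intro sum_nonneg mult_nonneg_nonneg lam_i_nonneg r_nonneg)
  have jk_le: "jump_kernel \<theta>a \<theta>d \<eta> n x A \<le> 1" for x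
  proof -
    have "jump_kernel \<theta>a \<theta>d \<eta> n x A \<le> (\<Sum>i<n. r i (fst x) * 1)"
      unfolding jump_kernel_def by (intro sum_mono mult_left_mono lam_i_le_1 r_nonneg)
    then show ?thesis using sum_r_i[OF pos(1,2,3)] by simp
  qed
  \<comment> \<open>The Markov assumption contains a Bochner integral, which is \<open>0\<close> by
    default for a non-integrable integrand; being bounded by \<open>1\<close>, this one agrees with
    the nonnegative integral.\<close>
  have int: "integrable M (\<lambda>\<omega>. indicator ?C \<omega> * jump_kernel \<theta>a \<theta>d \<eta> n (Y k \<omega>) A)"
    by (rule integrable_const_bound[where B=1])
       (use jk_meas jk_le jk_nonneg in \<open>auto simp: indicator_def\<close>)
  have "emeasure (distr (density M (\<lambda>\<omega>. ennreal (indicator ?C \<omega>))) (stateM n) (Y (Suc k))) A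
     = (\<integral>\<^sup>+\<omega>. ennreal (indicator ?C \<omega>) * indicator (Y (Suc k) -` A \<inter> space M) \<omega> \<partial>M)"
    by (subst emeasure_distr) (auto simp: emeasure_density)
  also have "\<dots> = (\<integral>\<^sup>+\<omega>. indicator {\<omega> \<in> space M. \<omega> \<in> ?C \<and> Y (Suc k) \<omega> \<in> A} \<omega> \<partial>M)"
    by (intro nn_integral_cong) (auto simp: indicator_def)
  also have "\<dots> = emeasure M {\<omega> \<in> space M. \<omega> \<in> ?C \<and> Y (Suc k) \<omega> \<in> A}"
    by (rule nn_integral_indicator) measurable
  also have "\<dots> = ennreal (\<integral>\<omega>. indicator ?C \<omega> * jump_kernel \<theta>a \<theta>d \<eta> n (Y k \<omega>) A \<partial>M)"
    by (simp add: emeasure_eq_measure mk)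
  also have "\<dots> = (\<integral>\<^sup>+\<omega>. ennreal (indicator ?C \<omega> * jump_kernel \<theta>a \<theta>d \<eta> n (Y k \<omega>) A) \<partial>M)"
    by (rule nn_integral_eq_integral[OF int, symmetric]) (use jk_nonneg in auto)
  also have "\<dots> = (\<integral>\<^sup>+\<omega>. (\<Sum>i<n. ennreal (indicator ?C \<omega> * r i (fst (Y k \<omega>))) * (\<integral>\<^sup>+y. indicator A (move n i (Y k \<omega>) y) \<partial>\<eta>)) \<partial>M)"
  proof (rule nn_integral_cong)
    fix \<omega> assume \<omega>: "\<omega> \<in> space M"
    have "indicator ?C \<omega> * jump_kernel \<theta>a \<theta>d \<eta> n (Y k \<omega>) A = (\<Sum>i<n. indicator ?C \<omega> * r i (fst (Y k \<omega>)) * lam_i \<eta> n i (Y k \<omega>) A)"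
      unfolding jump_kernel_def sum_distrib_left by (simp add: mult.assoc)
    then have "ennreal (indicator ?C \<omega> * jump_kernel \<theta>a \<theta>d \<eta> n (Y k \<omega>) A)
       = (\<Sum>i<n. ennreal (indicator ?C \<omega> * r i (fst (Y k \<omega>)) * lam_i \<eta> n i (Y k \<omega>) A))"
      by (simp add: sum_ennreal r_nonneg lam_i_nonneg)
    also have "\<dots> = (\<Sum>i<n. ennreal (indicator ?C \<omega> * r i (fst (Y k \<omega>))) * (\<integral>\<^sup>+y. indicator A (move n i (Y k \<omega>) y) \<partial>\<eta>))"
      using \<omega> by (intro sum.cong refl) (simp add: ennreal_mult r_nonneg lam_i_nonneg lam)
    finally show "ennreal (indicator ?C \<omega> * jump_kernel \<theta>a \<theta>d \<eta> n (Y k \<omega>) A) = \<dots>" .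
  qed
  also have "\<dots> = (\<Sum>i<n. \<integral>\<^sup>+\<omega>. ennreal (indicator ?C \<omega> * r i (fst (Y k \<omega>))) * (\<integral>\<^sup>+y. indicator A (move n i (Y k \<omega>) y) \<partial>\<eta>) \<partial>M)"
  proof (intro nn_integral_sum)
    fix i assume "i \<in> {..<n}"
    then have i: "i < n" by simp
    note [measurable] = borel_measurable_r_i_Y[OF i]
    show "(\<lambda>\<omega>. ennreal (indicator ?C \<omega> * r i (fst (Y k \<omega>))) * (\<integral>\<^sup>+y. indicator A (move n i (Y k \<omega>) y) \<partial>\<eta>)) \<in> borel_measurable M"
      using i by measurable
  qed
  also have "\<dots> = (\<Sum>i<n. \<integral>\<^sup>+\<omega>. \<integral>\<^sup>+y. ennreal (choice_weight k ?C (i, \<omega>, y)) * indicator A (choice_move k (i, \<omega>, y)) \<partial>\<eta> \<partial>M)"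
  proof (intro sum.cong refl nn_integral_cong)
    fix i \<omega> assume "i \<in> {..<n}" "\<omega> \<in> space M"
    then have i: "i < n" and "Y k \<omega> \<in> space (stateM n)" by (auto simp: space_stateM Y_in_Xset)
    then have "(\<lambda>y. indicator A (move n i (Y k \<omega>) y) :: ennreal) \<in> borel_measurable \<eta>" by measurable
    from nn_integral_cmult[OF this]
    show "ennreal (indicator ?C \<omega> * r i (fst (Y k \<omega>))) * (\<integral>\<^sup>+y. indicator A (move n i (Y k \<omega>) y) \<partial>\<eta>)
      = (\<integral>\<^sup>+y. ennreal (choice_weight k ?C (i, \<omega>, y)) * indicator A (choice_move k (i, \<omega>, y)) \<partial>\<eta>)"
      by (simp add: choice_weight_def choice_move_def)
  qed
  also have "\<dots> = (\<integral>\<^sup>+q. ennreal (choice_weight k ?C q) * indicator A (choice_move k q) \<partial>choice_space)"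
    by (rule nn_integral_choice_space[symmetric]) measurable
  also have "\<dots> = (\<integral>\<^sup>+q. ennreal (choice_weight k ?C q) * indicator (choice_move k -` A \<inter> space choice_space) q \<partial>choice_space)"
    by (intro nn_integral_cong) (auto simp: indicator_def)
  also have "\<dots> = emeasure (distr (density choice_space (\<lambda>q. ennreal (choice_weight k ?C q))) (stateM n) (choice_move k)) A"
    by (subst emeasure_distr) (auto simp: emeasure_density)
  finally show "emeasure (distr (density M (\<lambda>\<omega>. ennreal (indicator ?C \<omega>))) (stateM n) (Y (Suc k))) A = \<dots>" .
qed simp

text \<open>The version for nonnegative integrals, free of integrability conditions: it is what
  proves the moments finite. Conditions that always hold make the past event the whole
  space.\<close>

lemma nn_integral_next_state:
  assumes [measurable]: "F \<in> borel_measurable (stateM n)"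
  shows "(\<integral>\<^sup>+\<omega>. F (Y (Suc k) \<omega>) \<partial>M) = (\<Sum>i<n. \<integral>\<^sup>+\<omega>. \<integral>\<^sup>+y. ennreal (r i (fst (Y k \<omega>))) * F (move n i (Y k \<omega>) y) \<partial>\<eta> \<partial>M)"
proof -
  let ?B = "\<lambda>_::nat. space (stateM n) :: 'N state set" and ?C = "space M"
  have B: "\<And>j. ?B j \<in> sets (stateM n)" by simp
  have C: "history k ?B = ?C" using measurable_space[OF rv_Y] by (auto simp: history_def)
  have "(\<integral>\<^sup>+\<omega>. F (Y (Suc k) \<omega>) \<partial>M) = (\<integral>\<^sup>+\<omega>. ennreal (indicator ?C \<omega>) * F (Y (Suc k) \<omega>) \<partial>M)"
    by (intro nn_integral_cong) simp
  also have "\<dots> = (\<integral>\<^sup>+x. F x \<partial>distr (density M (\<lambda>\<omega>. ennreal (indicator ?C \<omega>))) (stateM n) (Y (Suc k)))"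
    by (subst nn_integral_distr, simp_all, subst nn_integral_density) auto
  also have "\<dots> = (\<integral>\<^sup>+x. F x \<partial>distr (density choice_space (\<lambda>q. ennreal (choice_weight k ?C q))) (stateM n) (choice_move k))"
    using distr_next_state[OF B, of k] by (simp only: C)
  also have "\<dots> = (\<integral>\<^sup>+q. ennreal (choice_weight k ?C q) * F (choice_move k q) \<partial>choice_space)"
    by (subst nn_integral_distr, simp_all, subst nn_integral_density) auto
  also have "\<dots> = (\<Sum>i<n. \<integral>\<^sup>+\<omega>. \<integral>\<^sup>+y. ennreal (choice_weight k ?C (i, \<omega>, y)) * F (choice_move k (i, \<omega>, y)) \<partial>\<eta> \<partial>M)"
    by (rule nn_integral_choice_space) measurable
  also have "\<dots> = (\<Sum>i<n. \<integral>\<^sup>+\<omega>. \<integral>\<^sup>+y. ennreal (r i (fst (Y k \<omega>))) * F (move n i (Y k \<omega>) y) \<partial>\<eta> \<partial>M)"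
    by (intro sum.cong refl nn_integral_cong) (simp add: choice_weight_def choice_move_def)
  finally show ?thesis .
qed

text \<open>Integrability is assumed only for the next state; the equality of laws carries it over
  to \<open>choice_space\<close>, where Fubini needs it.\<close>

lemma integral_next_state:
  assumes B: "\<And>j. B j \<in> sets (stateM n)" and F[measurable]: "F \<in> borel_measurable (stateM n)"
    and int: "integrable M (\<lambda>\<omega>. F (Y (Suc k) \<omega>))"
  shows "(\<integral>\<omega>. indicator (history k B) \<omega> * F (Y (Suc k) \<omega>) \<partial>M)
       = (\<integral>\<omega>. indicator (history k B) \<omega> * \<K> F (Y k \<omega>) \<partial>M)"
proof -
  let ?C = "history k B"
  have C[measurable]: "?C \<in> sets M" using B by (rule sets_history)
  let ?D = "density M (\<lambda>\<omega>. ennreal (indicator ?C \<omega>))"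
    and ?E = "density choice_space (\<lambda>q. ennreal (choice_weight k ?C q))"
  have "integrable M (\<lambda>\<omega>. indicator ?C \<omega> *\<^sub>R F (Y (Suc k) \<omega>))"
    by (rule integrable_mult_indicator[OF C int])
  then have "integrable ?D (\<lambda>\<omega>. F (Y (Suc k) \<omega>))"
    by (subst integrable_density) auto
  then have "integrable (distr ?D (stateM n) (Y (Suc k))) F"
    by (subst integrable_distr_eq) auto
  then have "integrable (distr ?E (stateM n) (choice_move k)) F"
    unfolding distr_next_state[OF B] .
  then have "integrable ?E (\<lambda>q. F (choice_move k q))"
    by (subst (asm) integrable_distr_eq) auto
  then have int2: "integrable choice_space (\<lambda>q. choice_weight k ?C q *\<^sub>R F (choice_move k q))"
    by (subst (asm) integrable_density) (auto simp: choice_weight_nonneg)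
  have "(\<integral>\<omega>. indicator ?C \<omega> * F (Y (Suc k) \<omega>) \<partial>M) = (\<integral>\<omega>. F (Y (Suc k) \<omega>) \<partial>?D)"
    by (subst integral_density) auto
  also have "\<dots> = (\<integral>x. F x \<partial>distr ?D (stateM n) (Y (Suc k)))"
    by (subst integral_distr) auto
  also have "\<dots> = (\<integral>x. F x \<partial>distr ?E (stateM n) (choice_move k))"
    unfolding distr_next_state[OF B] ..
  also have "\<dots> = (\<integral>q. F (choice_move k q) \<partial>?E)"
    by (subst integral_distr) auto
  also have "\<dots> = (\<integral>q. choice_weight k ?C q *\<^sub>R F (choice_move k q) \<partial>choice_space)"
    by (subst integral_density) (auto simp: choice_weight_nonneg)
  also have "\<dots> = (\<integral>\<omega>. (\<Sum>i<n. \<integral>y. choice_weight k ?C (i, \<omega>, y) *\<^sub>R F (choice_move k (i, \<omega>, y)) \<partial>\<eta>) \<partial>M)"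
    by (rule integral_choice_space[OF int2])
  also have "\<dots> = (\<integral>\<omega>. indicator ?C \<omega> * \<K> F (Y k \<omega>) \<partial>M)"
    by (intro Bochner_Integration.integral_cong refl)
       (simp add: choice_weight_def choice_move_def kernel_mean_def sum_distrib_left mult.assoc)
  finally show ?thesis .
qed

section \<open>First moments of the chain\<close>

lemma AE_norm_\<eta>: "AE y in \<eta>. norm y \<le> real CARD('N) * R"
  using bounded_\<eta>
proof eventually_elim
  case (elim y)
  have "norm y \<le> (\<Sum>i\<in>UNIV. \<bar>y $ i\<bar>)" by (rule norm_le_l1_cart)
  also have "\<dots> \<le> (\<Sum>i\<in>(UNIV :: 'N set). R)" using elim by (intro sum_mono) auto
  finally show ?case by simp
qed

lemma integrable_\<eta>: "integrable \<eta> (\<lambda>y. y)"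
proof -
  interpret E: prob_space \<eta> by (rule prob_\<eta>)
  show ?thesis by (rule E.integrable_const_bound[OF AE_norm_\<eta>]) measurable
qed

lemma integrable_\<eta>_nth: "integrable \<eta> (\<lambda>y. y $ b)"
  by (rule integrable_bounded_linear[OF bounded_linear_vec_nth integrable_\<eta>])

lemma integrable_total_norm_0: "integrable M (\<lambda>\<omega>. total_norm n (Y 0 \<omega>))"
proof -
  have "integrable \<rho> (total_norm n)"
    unfolding total_norm_def[abs_def] using integrable_\<rho> by (intro Bochner_Integration.integrable_sum integrable_norm) auto
  then show ?thesis unfolding distr_Y_0[symmetric] by (subst (asm) integrable_distr_eq) auto
qed

text \<open>Both claims come from one estimate of nonnegative integrals: finiteness gives
  integrability, and integrability turns the estimate into one for the Bochner integral.\<close>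

lemma integrable_total_norm_Suc:
  assumes int: "integrable M (\<lambda>\<omega>. total_norm n (Y k \<omega>))"
  shows "integrable M (\<lambda>\<omega>. total_norm n (Y (Suc k) \<omega>))"
    and "(\<integral>\<omega>. total_norm n (Y (Suc k) \<omega>) \<partial>M) \<le> 3 * (\<integral>\<omega>. total_norm n (Y k \<omega>) \<partial>M) + 2 * (real CARD('N) * R)"
proof -
  interpret E: prob_space \<eta> by (rule prob_\<eta>)
  let ?D = "real CARD('N) * R" and ?m = "\<lambda>\<omega>. total_norm n (Y k \<omega>)"
  have D: "0 \<le> ?D" using pos by simp
  have [measurable]: "(\<lambda>x. total_norm n x) \<in> borel_measurable (stateM n :: 'N state measure)" by measurable
  have "(\<integral>\<^sup>+\<omega>. ennreal (total_norm n (Y (Suc k) \<omega>)) \<partial>M)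
      = (\<Sum>i<n. \<integral>\<^sup>+\<omega>. \<integral>\<^sup>+y. ennreal (r i (fst (Y k \<omega>))) * ennreal (total_norm n (move n i (Y k \<omega>) y)) \<partial>\<eta> \<partial>M)"
    by (rule nn_integral_next_state) measurable
  also have "\<dots> \<le> (\<Sum>i<n. \<integral>\<^sup>+\<omega>. ennreal (r i (fst (Y k \<omega>)) * (3 * ?m \<omega> + 2 * ?D)) \<partial>M)"
  proof (intro sum_mono nn_integral_mono)
    fix i \<omega> assume "i \<in> {..<n}"
    then have i: "i < n" by simp
    have "(\<integral>\<^sup>+y. ennreal (r i (fst (Y k \<omega>))) * ennreal (total_norm n (move n i (Y k \<omega>) y)) \<partial>\<eta>)
       \<le> (\<integral>\<^sup>+y. ennreal (r i (fst (Y k \<omega>)) * (3 * ?m \<omega> + 2 * ?D)) \<partial>\<eta>)"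
    proof (rule nn_integral_mono_AE, use AE_norm_\<eta> in eventually_elim)
      fix y :: "real^'N" assume y: "norm y \<le> ?D"
      have "total_norm n (move n i (Y k \<omega>) y) \<le> 3 * ?m \<omega> + 2 * ?D"
        using total_norm_move_le[OF i, of "Y k \<omega>" y] y by simp
      then show "ennreal (r i (fst (Y k \<omega>))) * ennreal (total_norm n (move n i (Y k \<omega>) y))
          \<le> ennreal (r i (fst (Y k \<omega>)) * (3 * ?m \<omega> + 2 * ?D))"
        by (simp add: ennreal_mult[symmetric] r_nonneg total_norm_nonneg ennreal_leI mult_left_mono)
    qed
    then show "(\<integral>\<^sup>+y. ennreal (r i (fst (Y k \<omega>))) * ennreal (total_norm n (move n i (Y k \<omega>) y)) \<partial>\<eta>)
       \<le> ennreal (r i (fst (Y k \<omega>)) * (3 * ?m \<omega> + 2 * ?D))"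
      by (simp add: E.emeasure_space_1)
  qed
  also have "\<dots> = (\<integral>\<^sup>+\<omega>. (\<Sum>i<n. ennreal (r i (fst (Y k \<omega>)) * (3 * ?m \<omega> + 2 * ?D))) \<partial>M)"
    by (intro nn_integral_sum[symmetric]) measurable
  also have "\<dots> = (\<integral>\<^sup>+\<omega>. ennreal (3 * ?m \<omega> + 2 * ?D) \<partial>M)"
  proof (intro nn_integral_cong)
    fix \<omega>
    have "(\<Sum>i<n. ennreal (r i (fst (Y k \<omega>)) * (3 * ?m \<omega> + 2 * ?D))) = ennreal (\<Sum>i<n. r i (fst (Y k \<omega>)) * (3 * ?m \<omega> + 2 * ?D))"
      using pos(4) by (intro sum_ennreal mult_nonneg_nonneg r_nonneg add_nonneg_nonneg total_norm_nonneg) auto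
    also have "(\<Sum>i<n. r i (fst (Y k \<omega>)) * (3 * ?m \<omega> + 2 * ?D)) = 3 * ?m \<omega> + 2 * ?D"
      unfolding sum_distrib_right[symmetric] sum_r_i[OF pos(1,2,3)] by simp
    finally show "(\<Sum>i<n. ennreal (r i (fst (Y k \<omega>)) * (3 * ?m \<omega> + 2 * ?D))) = ennreal (3 * ?m \<omega> + 2 * ?D)" .
  qed
  also have "\<dots> = ennreal (\<integral>\<omega>. 3 * ?m \<omega> + 2 * ?D \<partial>M)"
    using int D by (intro nn_integral_eq_integral) (auto simp: total_norm_nonneg)
  also have "(\<integral>\<omega>. 3 * ?m \<omega> + 2 * ?D \<partial>M) = 3 * (\<integral>\<omega>. ?m \<omega> \<partial>M) + 2 * ?D"
    using int by (simp add: prob_space)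
  finally have le: "(\<integral>\<^sup>+\<omega>. ennreal (total_norm n (Y (Suc k) \<omega>)) \<partial>M) \<le> ennreal (3 * (\<integral>\<omega>. ?m \<omega> \<partial>M) + 2 * ?D)" .
  show int': "integrable M (\<lambda>\<omega>. total_norm n (Y (Suc k) \<omega>))"
    by (rule integrableI_bounded) (use le in \<open>auto simp: total_norm_nonneg le_less_trans\<close>)
  have "0 \<le> 3 * (\<integral>\<omega>. ?m \<omega> \<partial>M) + 2 * ?D"
    using pos(4) by (intro add_nonneg_nonneg mult_nonneg_nonneg Bochner_Integration.integral_nonneg total_norm_nonneg) auto
  with le show "(\<integral>\<omega>. total_norm n (Y (Suc k) \<omega>) \<partial>M) \<le> 3 * (\<integral>\<omega>. ?m \<omega> \<partial>M) + 2 * ?D"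
    by (subst (asm) nn_integral_eq_integral[OF int']) (auto simp: total_norm_nonneg ennreal_le_iff)
qed

lemma integrable_total_norm: "integrable M (\<lambda>\<omega>. total_norm n (Y k \<omega>))"
  by (induction k) (auto intro: integrable_total_norm_0 integrable_total_norm_Suc)

text \<open>The bound \<open>D\<close> on displacements is added because
  \<open>3 * a + 2 * D + D = 3 * (a + D)\<close>: the shifted means grow by a factor of at most
  \<open>3\<close> per step.\<close>

definition total_norm_bound :: real where
  "total_norm_bound = (\<integral>\<omega>. total_norm n (Y 0 \<omega>) \<partial>M) + real CARD('N) * R"

lemma expectation_total_norm_le: "(\<integral>\<omega>. total_norm n (Y k \<omega>) \<partial>M) \<le> 3 ^ k * total_norm_bound"
proof -
  have "(\<integral>\<omega>. total_norm n (Y k \<omega>) \<partial>M) + real CARD('N) * R \<le> 3 ^ k * total_norm_bound"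
  proof (induction k)
    case (Suc k)
    then show ?case using integrable_total_norm_Suc(2)[OF integrable_total_norm, of k] by simp
  qed (simp add: total_norm_bound_def)
  moreover have "0 \<le> real CARD('N) * R" using pos by simp
  ultimately show ?thesis by linarith
qed

section \<open>Conditioning on the counts along the first jumps\<close>

abbreviation (input) "chainM \<equiv> PiM UNIV (\<lambda>_::nat. stateM n :: 'N state measure)"

definition chain :: "'w \<Rightarrow> nat \<Rightarrow> 'N state" where
  "chain \<omega> = (\<lambda>k. Y k \<omega>)"

lemma measurable_chain[measurable]: "chain \<in> M \<rightarrow>\<^sub>M chainM"
  unfolding chain_def[abs_def] by (rule measurable_PiM_single') (auto dest: measurable_space[OF rv_Y])

abbreviation (input) "clockM \<equiv> PiM {1::nat..} (\<lambda>_. borel :: real measure)"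

definition clocks :: "'w \<Rightarrow> nat \<Rightarrow> real" where
  "clocks \<omega> = restrict (\<lambda>k. \<gamma> k \<omega>) {1..}"

lemma measurable_clocks[measurable]: "clocks \<in> M \<rightarrow>\<^sub>M clockM"
  unfolding clocks_def[abs_def] by (rule measurable_restrict) (auto intro: rv_\<gamma>)

text \<open>Extensional functions, so that the set is finite and each outcome belongs to the cell of
  exactly one path.\<close>

definition paths :: "nat \<Rightarrow> (nat \<Rightarrow> nat) set" where
  "paths k = PiE {..k} (\<lambda>_. {..n})"

definition cell :: "nat \<Rightarrow> (nat \<Rightarrow> nat) \<Rightarrow> 'w set" where
  "cell k j = {\<omega> \<in> space M. \<forall>i\<le>k. J i \<omega> = j i}"

lemma finite_paths: "finite (paths k)"
  unfolding paths_def by (intro finite_PiE) auto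

lemma paths_le: "j \<in> paths k \<Longrightarrow> i \<le> k \<Longrightarrow> j i \<le> n"
  by (auto simp: paths_def PiE_iff)

lemma cell_eq_history: "cell k j = history k (\<lambda>i. {x \<in> space (stateM n). card_psi n (fst x) = j i})"
  using measurable_space[OF rv_Y] by (auto simp: cell_def history_def J_def)

lemma sets_card_eq: "{x \<in> space (stateM n). card_psi n (fst x) = l} \<in> sets (stateM n :: 'N state measure)"
  by measurable

lemma sets_cell[measurable]: "cell k j \<in> sets M"
  unfolding cell_eq_history by (intro sets_history sets_card_eq)

text \<open>A partition of unity that also evaluates: inside a cell, an expression in the random
  counts may be replaced by one in the fixed path, and conversely.\<close>

lemma sum_cell:
  assumes "\<omega> \<in> space M"
  shows "(\<Sum>j\<in>paths k. indicator (cell k j) \<omega> * f j) = (f (restrict (\<lambda>i. J i \<omega>) {..k}) :: real)"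
proof -
  let ?j = "restrict (\<lambda>i. J i \<omega>) {..k}"
  have mem: "?j \<in> paths k" by (auto simp: paths_def J_le)
  have "indicator (cell k j) \<omega> = (if j = ?j then 1 else 0 :: real)" if "j \<in> paths k" for j
  proof -
    have "\<omega> \<in> cell k j \<longleftrightarrow> j = ?j"
      using that assms by (auto simp: cell_def paths_def fun_eq_iff PiE_def extensional_def restrict_def)
    then show ?thesis by (simp add: indicator_def)
  qed
  then have "(\<Sum>j\<in>paths k. indicator (cell k j) \<omega> * f j) = (\<Sum>j\<in>paths k. if j = ?j then f j else 0)"
    by (intro sum.cong) auto
  then show ?thesis using mem finite_paths by simp
qed

abbreviation (input) "\<tau> \<equiv> jump_time (rate_fun \<theta>a \<theta>d n) Y \<gamma>"

lemma jump_time_eq: "\<tau> i \<omega> = (\<Sum>m\<in>{1..i}. \<gamma> m \<omega> / c (J (m - 1) \<omega>))"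
  by (simp add: jump_time_def rate_fun_eq J_def)

lemma measurable_jump_time[measurable]: "\<tau> i \<in> borel_measurable M"
  unfolding jump_time_eq[abs_def]
  by (intro borel_measurable_sum borel_measurable_divide rv_\<gamma>) measurable

text \<open>The jump times with the counts frozen along \<open>j\<close>. They depend on the clocks
  alone and are therefore independent of the chain.\<close>

definition path_time :: "(nat \<Rightarrow> nat) \<Rightarrow> nat \<Rightarrow> 'w \<Rightarrow> real" where
  "path_time j i \<omega> = (\<Sum>m\<in>{1..i}. \<gamma> m \<omega> / c (j (m - 1)))"

text \<open>The wait before jump \<open>m\<close> is governed by the count after jump
  \<open>m - 1\<close>, so the counts up to index \<open>k\<close> determine the rates for jump
  times up to \<open>Suc k\<close>.\<close>

lemma jump_time_eq_path_time:
  assumes "i \<le> Suc k"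
  shows "\<tau> i \<omega> = path_time (restrict (\<lambda>i. J i \<omega>) {..k}) i \<omega>"
  unfolding jump_time_eq path_time_def using assms by (intro sum.cong) auto

lemma prob_path_time_le:
  assumes "j \<in> paths k" "i \<le> Suc k" "0 \<le> s"
  shows "(\<integral>\<omega>. indicator {..s} (path_time j i \<omega>) \<partial>M) = hypoexp_cdf (\<lambda>m. c (j m)) i s"
proof -
  have [measurable]: "path_time j i \<in> borel_measurable M"
    unfolding path_time_def[abs_def] by (intro borel_measurable_sum borel_measurable_divide rv_\<gamma>) auto
  have "(\<integral>\<omega>. indicator {..s} (path_time j i \<omega>) \<partial>M) = (\<integral>\<omega>. indicator {\<omega> \<in> space M. path_time j i \<omega> \<le> s} \<omega> \<partial>M)"
    by (intro Bochner_Integration.integral_cong) (auto simp: indicator_def)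
  also have "\<dots> = prob {\<omega> \<in> space M. path_time j i \<omega> \<le> s}"
    by (subst Bochner_Integration.integral_indicator) (auto intro!: arg_cong[where f=prob])
  also have "\<dots> = hypoexp_cdf (\<lambda>m. c (j m)) i s"
    unfolding path_time_def using assms exponential_\<gamma> paths_le[OF assms(1)]
    by (intro prob_sum_exponential_le[OF indep_\<gamma>]) (auto intro!: c_pos)
  finally show ?thesis .
qed

text \<open>On a cell the jump time is a \<open>path_time\<close>, so each summand factors. The
  function \<open>z\<close> may look at the whole chain, even beyond index \<open>k\<close>; this
  freedom is used for \<open>Y (Suc k)\<close> at \<open>i = Suc k\<close>.\<close>

lemma expectation_at_jump_time:
  assumes z[measurable]: "z \<in> borel_measurable chainM" and int: "integrable M (\<lambda>\<omega>. z (chain \<omega>))"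
    and i: "i \<le> Suc k" and s: "0 \<le> s"
  shows "(\<integral>\<omega>. z (chain \<omega>) * indicator {..s} (\<tau> i \<omega>) \<partial>M)
     = (\<Sum>j\<in>paths k. (\<integral>\<omega>. indicator (cell k j) \<omega> * z (chain \<omega>) \<partial>M) * hypoexp_cdf (\<lambda>m. c (j m)) i s)"
proof -
  have pt[measurable]: "path_time j i \<in> borel_measurable M" for j
    unfolding path_time_def[abs_def] by (intro borel_measurable_sum borel_measurable_divide rv_\<gamma>) auto
  have int_cell: "integrable M (\<lambda>\<omega>. indicator (cell k j) \<omega> * z (chain \<omega>))" for j
    using integrable_mult_indicator[OF sets_cell int] by simp
  have int_time: "integrable M (\<lambda>\<omega>. indicator {..s} (path_time j i \<omega>) :: real)" for j
    by (rule integrable_const_bound[where B=1]) auto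
  have factor: "integrable M (\<lambda>\<omega>. (indicator (cell k j) \<omega> * z (chain \<omega>)) * indicator {..s} (path_time j i \<omega>)) \<and>
     (\<integral>\<omega>. (indicator (cell k j) \<omega> * z (chain \<omega>)) * indicator {..s} (path_time j i \<omega>) \<partial>M)
      = (\<integral>\<omega>. indicator (cell k j) \<omega> * z (chain \<omega>) \<partial>M) * (\<integral>\<omega>. indicator {..s} (path_time j i \<omega>) \<partial>M)"
    (is "?int \<and> ?eq") for j
  proof -
    \<comment> \<open>The two factors are rewritten as functions on the sequence spaces of the chain
      and of the clocks, where the assumed independence applies.\<close>
    let ?z = "\<lambda>p. indicator {p \<in> space chainM. \<forall>i\<in>{..k}. card_psi n (fst (p i)) = j i} p * z p"
    let ?h = "\<lambda>g. indicator {..s} (\<Sum>m\<in>{1..i}. g m / c (j (m - 1))) :: real"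
    have cm: "(\<lambda>p. card_psi n (fst (p i))) \<in> chainM \<rightarrow>\<^sub>M count_space UNIV" for i
      by (rule measurable_compose[OF measurable_component_singleton[of i UNIV "\<lambda>_. stateM n"] measurable_card_psi]) simp
    have "{p \<in> space chainM. \<forall>i\<in>{..k}. card_psi n (fst (p i)) = j i} \<in> sets chainM"
      by (rule sets.sets_Collect_finite_All) (use cm in auto)
    then have z': "?z \<in> borel_measurable chainM" by measurable
    have h': "?h \<in> borel_measurable clockM"
    proof -
      have "(\<lambda>g. \<Sum>m\<in>{1..i}. g m / c (j (m - 1))) \<in> borel_measurable clockM"
        by (intro borel_measurable_sum borel_measurable_divide measurable_component_singleton) auto
      then show ?thesis by measurable
    qed
    have h_eq: "?h (clocks \<omega>) = indicator {..s} (path_time j i \<omega>)" for \<omega>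
      by (auto simp: clocks_def path_time_def intro!: arg_cong[where f="indicator {..s}"] sum.cong)
    have z_eq: "?z (chain \<omega>) = indicator (cell k j) \<omega> * z (chain \<omega>)" if "\<omega> \<in> space M" for \<omega>
      using measurable_space[OF measurable_chain that] that by (auto simp: indicator_def cell_def chain_def J_def)
    have ind: "indep_var borel (\<lambda>\<omega>. ?z (chain \<omega>)) borel (\<lambda>\<omega>. ?h (clocks \<omega>))"
      using indep_Y_\<gamma> unfolding chain_def[abs_def, symmetric] clocks_def[abs_def, symmetric]
      by (rule indep_var_of_indep_set[OF _ measurable_chain measurable_clocks z' h'])
    have iz: "integrable M (\<lambda>\<omega>. ?z (chain \<omega>))"
      using int_cell[of j] by (rule Bochner_Integration.integrable_cong[THEN iffD2, OF refl, rotated]) (rule z_eq)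
    have ih: "integrable M (\<lambda>\<omega>. ?h (clocks \<omega>))"
      unfolding h_eq by (rule int_time)
    have ?int
      using indep_var_integrable[OF ind iz ih] unfolding h_eq
      by (rule Bochner_Integration.integrable_cong[THEN iffD1, OF refl, rotated]) (simp only: z_eq)
    moreover have ?eq
    proof -
      have "(\<integral>\<omega>. (indicator (cell k j) \<omega> * z (chain \<omega>)) * indicator {..s} (path_time j i \<omega>) \<partial>M)
         = (\<integral>\<omega>. ?z (chain \<omega>) * ?h (clocks \<omega>) \<partial>M)"
        by (intro Bochner_Integration.integral_cong refl) (simp only: z_eq h_eq)
      also have "\<dots> = (\<integral>\<omega>. ?z (chain \<omega>) \<partial>M) * (\<integral>\<omega>. ?h (clocks \<omega>) \<partial>M)"
        by (rule indep_var_lebesgue_integral[OF ind iz ih])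
      also have "(\<integral>\<omega>. ?z (chain \<omega>) \<partial>M) = (\<integral>\<omega>. indicator (cell k j) \<omega> * z (chain \<omega>) \<partial>M)"
        by (intro Bochner_Integration.integral_cong refl) (simp only: z_eq)
      finally show ?thesis unfolding h_eq .
    qed
    ultimately show ?thesis ..
  qed
  have "(\<integral>\<omega>. z (chain \<omega>) * indicator {..s} (\<tau> i \<omega>) \<partial>M)
     = (\<integral>\<omega>. (\<Sum>j\<in>paths k. (indicator (cell k j) \<omega> * z (chain \<omega>)) * indicator {..s} (path_time j i \<omega>)) \<partial>M)"
    by (intro Bochner_Integration.integral_cong refl) (simp add: mult.assoc sum_cell jump_time_eq_path_time[OF i])
  also have "\<dots> = (\<Sum>j\<in>paths k. \<integral>\<omega>. (indicator (cell k j) \<omega> * z (chain \<omega>)) * indicator {..s} (path_time j i \<omega>) \<partial>M)"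
    using factor by (intro Bochner_Integration.integral_sum) simp
  also have "\<dots> = (\<Sum>j\<in>paths k. (\<integral>\<omega>. indicator (cell k j) \<omega> * z (chain \<omega>) \<partial>M) * hypoexp_cdf (\<lambda>m. c (j m)) i s)"
    by (intro sum.cong refl) (simp add: factor prob_path_time_le[OF _ i s])
  finally show ?thesis .
qed

abbreviation (input) "C \<equiv> (\<theta>a + \<theta>d) * real n"

lemma expectation_at_jump_time_le:
  assumes z[measurable]: "z \<in> borel_measurable chainM" and int: "integrable M (\<lambda>\<omega>. z (chain \<omega>))"
    and nonneg: "\<And>p. 0 \<le> z p" and s: "0 \<le> s"
  shows "(\<integral>\<omega>. z (chain \<omega>) * indicator {..s} (\<tau> i \<omega>) \<partial>M) \<le> (\<integral>\<omega>. z (chain \<omega>) \<partial>M) * ((C * s) ^ i / fact i)"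
proof -
  have int_cell: "integrable M (\<lambda>\<omega>. indicator (cell i j) \<omega> * z (chain \<omega>))" for j
    using integrable_mult_indicator[OF sets_cell int] by simp
  have "(\<integral>\<omega>. z (chain \<omega>) * indicator {..s} (\<tau> i \<omega>) \<partial>M)
     = (\<Sum>j\<in>paths i. (\<integral>\<omega>. indicator (cell i j) \<omega> * z (chain \<omega>) \<partial>M) * hypoexp_cdf (\<lambda>m. c (j m)) i s)"
    by (rule expectation_at_jump_time[OF z int _ s]) simp
  also have "\<dots> \<le> (\<Sum>j\<in>paths i. (\<integral>\<omega>. indicator (cell i j) \<omega> * z (chain \<omega>) \<partial>M) * ((C * s) ^ i / fact i))"
  proof (intro sum_mono mult_left_mono hypoexp_cdf_le conjI s)
    fix j m assume jm: "j \<in> paths i" "m < i"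
    then have "j m \<le> n" using paths_le by simp
    then show "0 \<le> c (j m)" "c (j m) \<le> C"
      using c_pos[of "j m"] card_rate_le[of \<theta>a \<theta>d "j m" n] pos by auto
  qed (auto intro!: Bochner_Integration.integral_nonneg mult_nonneg_nonneg nonneg)
  also have "\<dots> = (\<integral>\<omega>. (\<Sum>j\<in>paths i. indicator (cell i j) \<omega> * z (chain \<omega>)) \<partial>M) * ((C * s) ^ i / fact i)"
    by (subst Bochner_Integration.integral_sum, rule int_cell, rule sum_distrib_right[symmetric])
  also have "(\<integral>\<omega>. (\<Sum>j\<in>paths i. indicator (cell i j) \<omega> * z (chain \<omega>)) \<partial>M) = (\<integral>\<omega>. z (chain \<omega>) \<partial>M)"
    by (intro Bochner_Integration.integral_cong refl sum_cell)
  finally show ?thesis .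
qed

lemma measurable_coordinate: "F \<in> borel_measurable (stateM n) \<Longrightarrow> (\<lambda>p. F (p k)) \<in> borel_measurable chainM"
  by (rule measurable_compose[OF measurable_component_singleton[of k UNIV "\<lambda>_. stateM n"]]) simp_all

text \<open>Both sides expand over the same cells at level \<open>k\<close> with the same
  distribution functions, since these cells already determine the rates up to jump
  \<open>Suc k\<close>. A cell is an event of the past, so within it one step of the chain may be
  averaged out.\<close>

lemma expectation_markov_at_jump_time:
  assumes F: "F \<in> borel_measurable (stateM n)" and G: "G \<in> borel_measurable (stateM n)"
    and intF: "integrable M (\<lambda>\<omega>. F (Y (Suc k) \<omega>))" and intG: "integrable M (\<lambda>\<omega>. G (Y k \<omega>))"
    and G_eq: "\<And>x. x \<in> Xset n \<Longrightarrow> \<K> F x = G x" and s: "0 \<le> s"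
  shows "(\<integral>\<omega>. F (Y (Suc k) \<omega>) * indicator {..s} (\<tau> (Suc k) \<omega>) \<partial>M)
       = (\<integral>\<omega>. G (Y k \<omega>) * indicator {..s} (\<tau> (Suc k) \<omega>) \<partial>M)"
proof -
  have "(\<integral>\<omega>. F (chain \<omega> (Suc k)) * indicator {..s} (\<tau> (Suc k) \<omega>) \<partial>M)
     = (\<Sum>j\<in>paths k. (\<integral>\<omega>. indicator (cell k j) \<omega> * F (chain \<omega> (Suc k)) \<partial>M) * hypoexp_cdf (\<lambda>m. c (j m)) (Suc k) s)"
    by (rule expectation_at_jump_time[OF measurable_coordinate[OF F]])
       (use intF s in \<open>simp_all add: chain_def\<close>)
  also have "\<dots> = (\<Sum>j\<in>paths k. (\<integral>\<omega>. indicator (cell k j) \<omega> * G (chain \<omega> k) \<partial>M) * hypoexp_cdf (\<lambda>m. c (j m)) (Suc k) s)"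
  proof (intro sum.cong refl arg_cong2[where f="(*)"])
    fix j
    have "(\<integral>\<omega>. indicator (cell k j) \<omega> * F (Y (Suc k) \<omega>) \<partial>M) = (\<integral>\<omega>. indicator (cell k j) \<omega> * \<K> F (Y k \<omega>) \<partial>M)"
      unfolding cell_eq_history by (rule integral_next_state[OF sets_card_eq F intF])
    also have "\<dots> = (\<integral>\<omega>. indicator (cell k j) \<omega> * G (Y k \<omega>) \<partial>M)"
      by (intro Bochner_Integration.integral_cong refl) (simp add: G_eq Y_in_Xset)
    finally show "(\<integral>\<omega>. indicator (cell k j) \<omega> * F (chain \<omega> (Suc k)) \<partial>M) = (\<integral>\<omega>. indicator (cell k j) \<omega> * G (chain \<omega> k) \<partial>M)"
      by (simp add: chain_def)
  qed
  also have "\<dots> = (\<integral>\<omega>. G (chain \<omega> k) * indicator {..s} (\<tau> (Suc k) \<omega>) \<partial>M)"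
    by (rule expectation_at_jump_time[OF measurable_coordinate[OF G], symmetric])
       (use intG s in \<open>simp_all add: chain_def\<close>)
  finally show ?thesis by (simp add: chain_def)
qed

section \<open>Departures from a given count\<close>

text \<open>\<open>W\<close> and \<open>A\<close> are the families \<open>W\<close> and
  \<open>a\<close> of \<open>stationary_jump_count_limit\<close>: state \<open>k\<close> is left at
  jump \<open>Suc k\<close> and entered at jump \<open>k\<close>.\<close>

definition W :: "nat \<Rightarrow> nat \<Rightarrow> real \<Rightarrow> real" where
  "W k l s = (\<integral>\<omega>. indicator {l} (J k \<omega>) * indicator {..s} (\<tau> (Suc k) \<omega>) \<partial>M)"

definition A :: "nat \<Rightarrow> nat \<Rightarrow> real \<Rightarrow> real" where
  "A k l s = (\<integral>\<omega>. indicator {l} (J k \<omega>) * indicator {..s} (\<tau> k \<omega>) \<partial>M)"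

lemma integrable_mult_time:
  fixes f :: "'w \<Rightarrow> real"
  assumes "integrable M f"
  shows "integrable M (\<lambda>\<omega>. f \<omega> * indicator {..s} (\<tau> k \<omega>))"
  by (rule Bochner_Integration.integrable_bound[OF assms])
     (use assms in \<open>auto simp: indicator_def\<close>)

lemma integrable_fun_J: "integrable M (\<lambda>\<omega>. g (J k \<omega>) :: real)"
proof (rule integrable_const_bound[where B="Max ((\<lambda>m. \<bar>g m\<bar>) ` {..n})"])
  show "AE \<omega> in M. norm (g (J k \<omega>)) \<le> Max ((\<lambda>m. \<bar>g m\<bar>) ` {..n})"
    by (intro AE_I2) (auto intro!: Max_ge simp: J_le)
qed (rule measurable_compose[OF rv_J], simp)

lemma expectation_fun_J: "(\<integral>\<omega>. g (J k \<omega>) * indicator {..s} (\<tau> (Suc k) \<omega>) \<partial>M) = (\<Sum>m\<le>n. g m * W k m s)"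
proof -
  have "(\<integral>\<omega>. g (J k \<omega>) * indicator {..s} (\<tau> (Suc k) \<omega>) \<partial>M)
      = (\<integral>\<omega>. (\<Sum>m\<le>n. g m * (indicator {m} (J k \<omega>) * indicator {..s} (\<tau> (Suc k) \<omega>))) \<partial>M)"
  proof (intro Bochner_Integration.integral_cong refl)
    fix \<omega>
    have "(\<Sum>m\<le>n. g m * (indicator {m} (J k \<omega>) * indicator {..s} (\<tau> (Suc k) \<omega>)))
       = (\<Sum>m\<le>n. if J k \<omega> = m then g m * indicator {..s} (\<tau> (Suc k) \<omega>) else 0)"
      by (intro sum.cong) (auto simp: indicator_def)
    then show "g (J k \<omega>) * indicator {..s} (\<tau> (Suc k) \<omega>) = (\<Sum>m\<le>n. g m * (indicator {m} (J k \<omega>) * indicator {..s} (\<tau> (Suc k) \<omega>)))"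
      by (simp add: J_le)
  qed
  also have "\<dots> = (\<Sum>m\<le>n. \<integral>\<omega>. g m * (indicator {m} (J k \<omega>) * indicator {..s} (\<tau> (Suc k) \<omega>)) \<partial>M)"
    by (intro Bochner_Integration.integral_sum integrable_mult_right integrable_mult_time integrable_fun_J)
  finally show ?thesis by (simp add: W_def)
qed

lemma occupation_at_jump_time:
  assumes i: "i \<le> Suc k" and s: "0 \<le> s"
  shows "(\<integral>\<omega>. indicator {l} (J k \<omega>) * indicator {..s} (\<tau> i \<omega>) \<partial>M)
     = (\<Sum>j\<in>paths k. (\<integral>\<omega>. indicator (cell k j) \<omega> * indicator {l} (J k \<omega>) \<partial>M) * hypoexp_cdf (\<lambda>m. c (j m)) i s)"
proof -
  have m: "(\<lambda>x. indicator {l} (card_psi n (fst x)) :: real) \<in> borel_measurable (stateM n :: 'N state measure)"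
    by (rule measurable_compose[OF measurable_card_psi]) simp
  have eq: "indicator {l} (card_psi n (fst (chain \<omega> k))) = (indicator {l} (J k \<omega>) :: real)" for \<omega>
    by (simp add: chain_def J_def)
  from expectation_at_jump_time[OF measurable_coordinate[OF m, of k], unfolded eq, OF integrable_fun_J i s]
  show ?thesis .
qed

lemma W_eq:
  "0 \<le> s \<Longrightarrow> W k l s = (\<Sum>j\<in>paths k. (\<integral>\<omega>. indicator (cell k j) \<omega> * indicator {l} (J k \<omega>) \<partial>M) * hypoexp_cdf (\<lambda>m. c (j m)) (Suc k) s)"
  unfolding W_def by (rule occupation_at_jump_time) auto

lemma A_eq:
  "0 \<le> s \<Longrightarrow> A k l s = (\<Sum>j\<in>paths k. (\<integral>\<omega>. indicator (cell k j) \<omega> * indicator {l} (J k \<omega>) \<partial>M) * hypoexp_cdf (\<lambda>m. c (j m)) k s)"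
  unfolding A_def by (rule occupation_at_jump_time) auto

lemma W_deriv:
  assumes s: "0 \<le> s"
  shows "(W k l has_real_derivative c l * (A k l s - W k l s)) (at s within {0..})"
proof -
  let ?q = "\<lambda>j. (\<integral>\<omega>. indicator (cell k j) \<omega> * indicator {l} (J k \<omega>) \<partial>M) :: real"
  let ?H = "\<lambda>j. hypoexp_cdf (\<lambda>m. c (j m))"
  \<comment> \<open>The coefficient of a path vanishes unless the path ends at \<open>l\<close>, so
    the rate of its last state can be replaced by \<open>c l\<close> and pulled out of the
    sum.\<close>
  have q: "?q j * c (j k) = ?q j * c l" for j
  proof (cases "j k = l")
    case False
    have "?q j = (\<integral>\<omega>. 0 \<partial>M)"
      using False by (intro Bochner_Integration.integral_cong refl) (auto simp: indicator_def cell_def)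
    then show ?thesis by simp
  qed simp
  have "((\<lambda>s. \<Sum>j\<in>paths k. ?q j * ?H j (Suc k) s) has_real_derivative
     (\<Sum>j\<in>paths k. ?q j * (c (j k) * (?H j k s - ?H j (Suc k) s)))) (at s within {0..})"
    by (intro DERIV_sum DERIV_cmult hypoexp_cdf_deriv s)
  also have "(\<Sum>j\<in>paths k. ?q j * (c (j k) * (?H j k s - ?H j (Suc k) s)))
      = (\<Sum>j\<in>paths k. c l * (?q j * ?H j k s - ?q j * ?H j (Suc k) s))"
    by (intro sum.cong refl) (simp only: mult.assoc[symmetric] q, simp only: algebra_simps)
  also have "\<dots> = c l * (A k l s - W k l s)"
    unfolding W_eq[OF s] A_eq[OF s] sum_subtractf[symmetric] sum_distrib_left ..
  finally show ?thesis
    by (rule has_field_derivative_transform_within[where d=1]) (use s in \<open>auto simp: W_eq\<close>)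
qed

lemma W_0: "W k l 0 = 0"
  by (simp add: W_eq)

lemma W_nonneg: "0 \<le> W k l s"
  unfolding W_def by (intro Bochner_Integration.integral_nonneg) simp

lemma A_0:
  assumes "0 \<le> s"
  shows "A 0 l s = \<sigma> l"
proof -
  have "emeasure M {\<omega> \<in> space M. J 0 \<omega> = l} = emeasure (distr \<rho> (count_space UNIV) (\<lambda>x. card_psi n (fst x))) {l}"
  proof -
    have m: "(\<lambda>x. card_psi n (fst x)) \<in> \<rho> \<rightarrow>\<^sub>M count_space UNIV"
      using measurable_card_psi measurable_cong_sets[OF sets_\<rho> refl] by blast
    have "emeasure (distr \<rho> (count_space UNIV) (\<lambda>x. card_psi n (fst x))) {l}
      = emeasure \<rho> ((\<lambda>x. card_psi n (fst x)) -` {l} \<inter> space \<rho>)"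
      by (rule emeasure_distr[OF m]) simp
    also have "\<dots> = emeasure (distr M (stateM n) (Y 0)) ((\<lambda>x. card_psi n (fst x)) -` {l} \<inter> space (stateM n))"
      using sets_eq_imp_space_eq[OF sets_\<rho>] by (simp add: distr_Y_0)
    also have "\<dots> = emeasure M (Y 0 -` ((\<lambda>x. card_psi n (fst x)) -` {l} \<inter> space (stateM n)) \<inter> space M)"
      by (rule emeasure_distr[OF rv_Y]) (rule measurable_sets[OF measurable_card_psi], simp)
    also have "Y 0 -` ((\<lambda>x. card_psi n (fst x)) -` {l} \<inter> space (stateM n)) \<inter> space M = {\<omega> \<in> space M. J 0 \<omega> = l}"
      using measurable_space[OF rv_Y] by (auto simp: J_def)
    finally show ?thesis by simp
  qed
  also have "\<dots> = ennreal (\<sigma> l)"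
    unfolding card_\<rho> by (subst emeasure_density) (auto simp: nn_integral_indicator_singleton)
  finally have "prob {\<omega> \<in> space M. J 0 \<omega> = l} = \<sigma> l"
    using pos by (simp add: measure_def sigma_w_def)
  moreover have "A 0 l s = (\<integral>\<omega>. indicator {\<omega> \<in> space M. J 0 \<omega> = l} \<omega> \<partial>M)"
    unfolding A_def using assms
    by (intro Bochner_Integration.integral_cong refl) (auto simp: indicator_def jump_time_def)
  moreover have "(\<integral>\<omega>. indicator {\<omega> \<in> space M. J 0 \<omega> = l} \<omega> \<partial>M) = prob {\<omega> \<in> space M. J 0 \<omega> = l}"
    by (subst Bochner_Integration.integral_indicator) (auto intro!: arg_cong[where f=prob])
  ultimately show ?thesis by simp
qed

lemma kernel_mean_indicator_card:
  "\<K> (\<lambda>x. indicator {l} (card_psi n (fst x))) x = card_step \<theta>a \<theta>d n (card_psi n (fst x)) l"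
proof -
  interpret E: prob_space \<eta> by (rule prob_\<eta>)
  have "\<K> (\<lambda>x. indicator {l} (card_psi n (fst x))) x
     = (\<Sum>i<n. r i (fst x) * of_bool (card_psi n (s_i i (fst x)) = l))"
    unfolding kernel_mean_def
    by (intro sum.cong refl) (simp add: move_def indicator_def E.prob_space)
  then show ?thesis by (simp only: sum_r_i_card_step)
qed

text \<open>Entering state \<open>Suc k\<close> is the same jump as leaving state \<open>k\<close>;
  at that jump the count makes one step of its own chain.\<close>

lemma A_Suc:
  assumes s: "0 \<le> s"
  shows "A (Suc k) l s = (\<Sum>m\<le>n. card_step \<theta>a \<theta>d n m l * W k m s)"
proof -
  let ?F = "\<lambda>x :: 'N state. indicator {l} (card_psi n (fst x)) :: real"
  let ?G = "\<lambda>x :: 'N state. card_step \<theta>a \<theta>d n (card_psi n (fst x)) l"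
  have "A (Suc k) l s = (\<integral>\<omega>. ?F (Y (Suc k) \<omega>) * indicator {..s} (\<tau> (Suc k) \<omega>) \<partial>M)"
    by (simp add: A_def J_def)
  also have "\<dots> = (\<integral>\<omega>. ?G (Y k \<omega>) * indicator {..s} (\<tau> (Suc k) \<omega>) \<partial>M)"
  proof (rule expectation_markov_at_jump_time)
    show "?F \<in> borel_measurable (stateM n)" by (rule measurable_compose[OF measurable_card_psi]) simp
    show "?G \<in> borel_measurable (stateM n)" by (rule measurable_compose[OF measurable_card_psi]) simp
    show "integrable M (\<lambda>\<omega>. ?F (Y (Suc k) \<omega>))" "integrable M (\<lambda>\<omega>. ?G (Y k \<omega>))"
      using integrable_fun_J[of "indicator {l}" "Suc k"] integrable_fun_J[of "\<lambda>m. card_step \<theta>a \<theta>d n m l" k]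
      by (simp_all add: J_def)
  qed (use s in \<open>simp_all add: kernel_mean_indicator_card\<close>)
  also have "\<dots> = (\<Sum>m\<le>n. card_step \<theta>a \<theta>d n m l * W k m s)"
    using expectation_fun_J[of "\<lambda>m. card_step \<theta>a \<theta>d n m l" k s] by (simp add: J_def)
  finally show ?thesis .
qed

lemma sum_W_le:
  assumes s: "0 \<le> s"
  shows "(\<Sum>l\<le>n. W k l s) \<le> (C * s) ^ Suc k / fact (Suc k)"
proof -
  have "(\<Sum>l\<le>n. W k l s) = (\<integral>\<omega>. 1 * indicator {..s} (\<tau> (Suc k) \<omega>) \<partial>M)"
    using expectation_fun_J[of "\<lambda>_. 1" k s] by simp
  also have "\<dots> \<le> (\<integral>\<omega>. 1 \<partial>M) * ((C * s) ^ Suc k / fact (Suc k))"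
    by (rule expectation_at_jump_time_le[of "\<lambda>_. 1"]) (use s in auto)
  finally show ?thesis by (simp add: prob_space)
qed

lemma W_limit:
  assumes l: "l \<le> n" and s: "0 \<le> s"
  shows "(\<lambda>K. \<Sum>k<K. W k l s) \<longlonglongrightarrow> c l * \<sigma> l * s"
proof (rule stationary_jump_count_limit[where W=W and a=A and T="card_step \<theta>a \<theta>d n" and C=C and n=n])
  fix m l assume "m \<le> n" "l \<le> n"
  then show "0 \<le> card_step \<theta>a \<theta>d n m l"
    using pos c_pos[of m] unfolding card_step_def
    by (intro divide_nonneg_pos add_nonneg_nonneg mult_nonneg_nonneg) auto
next
  fix l assume "l \<le> n"
  then show "0 \<le> c l \<and> c l \<le> C"
    using c_pos[of l] card_rate_le[of \<theta>a \<theta>d l n] pos by auto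
qed (use l s pos in \<open>auto simp: W_deriv W_0 W_nonneg A_0 A_Suc sum_card_step sigma_w_stationary sum_W_le
    simp del: fact_Suc power_Suc\<close>)

section \<open>From the jump chain to the process in continuous time\<close>

lemma AE_\<gamma>_pos: "AE \<omega> in M. \<forall>k\<ge>1. 0 < \<gamma> k \<omega>"
proof -
  have "AE \<omega> in M. 0 < \<gamma> k \<omega>" if "1 \<le> k" for k
  proof -
    have d: "distributed M lborel (\<gamma> k) (exponential_density 1)" using exponential_\<gamma> that by simp
    have "AE x in distr M lborel (\<gamma> k). 0 < x"
      unfolding distributed_distr_eq_density[OF d]
    proof (subst AE_density)
      show "AE x in lborel. 0 < ennreal (exponential_density 1 x) \<longrightarrow> 0 < x"
        \<comment> \<open>The density equals \<open>1\<close> at \<open>0\<close>, so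
          \<open>0\<close> has to be removed as a null set. Strict positivity is what makes the jump
          times strictly increasing.\<close>
        using AE_lborel_singleton[of "0::real"] by eventually_elim (auto simp: exponential_density_def)
    qed auto
    then show ?thesis
      using rv_\<gamma>[OF that] by (subst (asm) AE_distr_iff) auto
  qed
  then have "\<forall>k. AE \<omega> in M. 1 \<le> k \<longrightarrow> 0 < \<gamma> k \<omega>" by auto
  then show ?thesis unfolding AE_all_countable .
qed

text \<open>If all jumps happen by time \<open>s\<close>, then so does jump \<open>k\<close>, for
  each \<open>k\<close>; this has probability at most \<open>(C * s) ^ k / fact k\<close>.\<close>

lemma AE_no_explosion:
  assumes s: "0 \<le> s"
  shows "AE \<omega> in M. \<exists>k. s < \<tau> k \<omega>"
proof -
  let ?E = "{\<omega> \<in> space M. \<forall>k. \<tau> k \<omega> \<le> s}"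
  have E[measurable]: "?E \<in> sets M" by measurable
  have "prob ?E \<le> (C * s) ^ k / fact k" for k
  proof -
    have "prob ?E = (\<integral>\<omega>. indicator ?E \<omega> \<partial>M)"
      using E by simp
    also have "\<dots> \<le> (\<integral>\<omega>. 1 * indicator {..s} (\<tau> k \<omega>) \<partial>M)"
    proof (rule Bochner_Integration.integral_mono)
      show "integrable M (indicator ?E :: 'w \<Rightarrow> real)"
        using E by (simp add: integrable_indicator_iff emeasure_eq_measure)
      show "integrable M (\<lambda>\<omega>. 1 * indicator {..s} (\<tau> k \<omega>) :: real)"
        by (rule integrable_mult_time) simp
    qed (auto simp: indicator_def)
    also have "\<dots> \<le> (\<integral>\<omega>. 1 \<partial>M) * ((C * s) ^ k / fact k)"
      by (rule expectation_at_jump_time_le[of "\<lambda>_. 1"]) (use s in auto)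
    finally show ?thesis by (simp add: prob_space)
  qed
  then have "prob ?E \<le> 0"
    using LIMSEQ_le_const[OF power_over_fact_tendsto_0[of "C * s"], of "prob ?E"] by auto
  then have "prob ?E = 0" using measure_nonneg[of M ?E] by linarith
  then have "AE \<omega> in M. \<omega> \<notin> ?E" by (simp add: prob_eq_0 E)
  then show ?thesis
  proof (rule AE_mp, intro AE_I2 impI)
    fix \<omega> assume "\<omega> \<in> space M" "\<omega> \<notin> ?E"
    then show "\<exists>k. s < \<tau> k \<omega>" by (auto simp: not_le)
  qed
qed

abbreviation (input) "X \<equiv> Xproc (rate_fun \<theta>a \<theta>d n) Y \<gamma>"

lemma measurable_X[measurable]: "X s \<in> M \<rightarrow>\<^sub>M stateM n"
  unfolding Xproc_def[abs_def]
  by (rule measurable_compose_countable[where f=Y]) (use rv_Y in \<open>auto intro!: measurable_Least\<close>)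

text \<open>Only the term of the current state is nonzero, which gives the value of the series and
  its absolute summability; both are needed to exchange it with the expectation.\<close>

lemma AE_X_sum:
  fixes F :: "'N state \<Rightarrow> real"
  assumes s: "0 \<le> s"
  shows "AE \<omega> in M. (\<lambda>k. F (Y k \<omega>) * (indicator {..s} (\<tau> k \<omega>) - indicator {..s} (\<tau> (Suc k) \<omega>))) sums F (X s \<omega>)
     \<and> summable (\<lambda>k. norm (F (Y k \<omega>) * (indicator {..s} (\<tau> k \<omega>) - indicator {..s} (\<tau> (Suc k) \<omega>))))"
  using AE_\<gamma>_pos AE_no_explosion[OF s]
proof eventually_elim
  case (elim \<omega>)
  let ?N = "LEAST k. \<tau> k \<omega> \<le> s \<and> s < \<tau> (Suc k) \<omega>"
  have inc: "\<tau> k \<omega> < \<tau> (Suc k) \<omega>" for k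
    using elim(1) c_pos[OF J_le, of k \<omega>] by (simp add: jump_time_eq)
  have "\<tau> 0 \<omega> \<le> s" using s by (simp add: jump_time_def)
  note ind = LEAST_level_crossing[of "\<lambda>k. \<tau> k \<omega>", OF inc this elim(2)]
  have eq: "F (Y k \<omega>) * (indicator {..s} (\<tau> k \<omega>) - indicator {..s} (\<tau> (Suc k) \<omega>)) = (if k = ?N then F (Y ?N \<omega>) else 0)" for k
    unfolding ind by simp
  have "(\<lambda>k. if k = ?N then F (Y ?N \<omega>) else 0) sums F (Y ?N \<omega>)"
    by (rule sums_single)
  moreover have "summable (\<lambda>k. norm (if k = ?N then F (Y ?N \<omega>) else 0))"
    by (rule summable_finite[of "{?N}"]) auto
  ultimately show ?case unfolding eq by (simp add: Xproc_def)
qed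

lemma expectation_total_norm_at_jump_time_le:
  assumes s: "0 \<le> s"
  shows "(\<integral>\<omega>. total_norm n (Y k \<omega>) * indicator {..s} (\<tau> i \<omega>) \<partial>M) \<le> 3 ^ k * total_norm_bound * ((C * s) ^ i / fact i)"
proof -
  have "(\<integral>\<omega>. total_norm n (chain \<omega> k) * indicator {..s} (\<tau> i \<omega>) \<partial>M) \<le> (\<integral>\<omega>. total_norm n (chain \<omega> k) \<partial>M) * ((C * s) ^ i / fact i)"
    by (rule expectation_at_jump_time_le[OF measurable_coordinate[OF measurable_total_norm]])
       (use integrable_total_norm s in \<open>simp_all add: chain_def total_norm_nonneg\<close>)
  also have "\<dots> \<le> 3 ^ k * total_norm_bound * ((C * s) ^ i / fact i)"
    using expectation_total_norm_le[of k] s pos by (intro mult_right_mono) (auto simp: chain_def)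
  finally show ?thesis by (simp add: chain_def)
qed

section \<open>Means of functions of the process\<close>

text \<open>Domination by \<open>total_norm\<close> makes the first-moment bounds available; the
  components of the centroid are the intended instances.\<close>

context
  fixes F :: "'N state \<Rightarrow> real"
  assumes F[measurable]: "F \<in> borel_measurable (stateM n)" and F_le: "\<And>x. \<bar>F x\<bar> \<le> total_norm n x"
begin

lemma integrable_F: "integrable M (\<lambda>\<omega>. F (Y k \<omega>))"
  by (rule Bochner_Integration.integrable_bound[OF integrable_total_norm[of k]])
     (use F_le in \<open>auto simp: total_norm_nonneg\<close>)

text \<open>This is the remainder of the telescoping sum. The moments grow at most like
  \<open>3 ^ k\<close>, so it is bounded by a multiple of
  \<open>(3 * (C * s)) ^ k / fact k\<close>.\<close>

lemma expectation_F_at_jump_time_tendsto_0: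
  assumes s: "0 \<le> s"
  shows "(\<lambda>k. \<integral>\<omega>. F (Y k \<omega>) * indicator {..s} (\<tau> k \<omega>) \<partial>M) \<longlonglongrightarrow> 0"
proof (rule Lim_null_comparison)
  show "\<forall>\<^sub>F k in sequentially. norm (\<integral>\<omega>. F (Y k \<omega>) * indicator {..s} (\<tau> k \<omega>) \<partial>M) \<le> total_norm_bound * ((3 * (C * s)) ^ k / fact k)"
  proof (intro always_eventually allI)
    fix k
    have "norm (\<integral>\<omega>. F (Y k \<omega>) * indicator {..s} (\<tau> k \<omega>) \<partial>M) \<le> (\<integral>\<omega>. norm (F (Y k \<omega>) * indicator {..s} (\<tau> k \<omega>)) \<partial>M)"
      by (rule integral_norm_bound)
    also have "\<dots> \<le> (\<integral>\<omega>. total_norm n (Y k \<omega>) * indicator {..s} (\<tau> k \<omega>) \<partial>M)"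
      by (intro Bochner_Integration.integral_mono integrable_norm integrable_mult_time integrable_total_norm integrable_F)
         (use F_le in \<open>auto simp: indicator_def total_norm_nonneg\<close>)
    also have "\<dots> \<le> 3 ^ k * total_norm_bound * ((C * s) ^ k / fact k)"
      by (rule expectation_total_norm_at_jump_time_le[OF s])
    also have "\<dots> = total_norm_bound * ((3 * (C * s)) ^ k / fact k)"
      by (simp only: power_mult_distrib) (simp add: mult_ac)
    finally show "norm (\<integral>\<omega>. F (Y k \<omega>) * indicator {..s} (\<tau> k \<omega>) \<partial>M) \<le> total_norm_bound * ((3 * (C * s)) ^ k / fact k)" .
  qed
  show "(\<lambda>k. total_norm_bound * ((3 * (C * s)) ^ k / fact k)) \<longlonglongrightarrow> 0"
    using tendsto_mult_left[OF power_over_fact_tendsto_0, of total_norm_bound "3 * (C * s)"] by simp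
qed

text \<open>The mean norms of the terms are dominated by multiples of two consecutive terms of the
  exponential series at \<open>3 * (C * s)\<close>. Hence the series of \<open>AE_X_sum\<close> may
  be integrated term by term, and its sum is integrable.\<close>

lemma
  assumes s: "0 \<le> s"
  shows integrable_X: "integrable M (\<lambda>\<omega>. F (X s \<omega>))"
    and expectation_X_series: "(\<lambda>k. (\<integral>\<omega>. F (Y k \<omega>) * indicator {..s} (\<tau> k \<omega>) \<partial>M)
         - (\<integral>\<omega>. F (Y k \<omega>) * indicator {..s} (\<tau> (Suc k) \<omega>) \<partial>M)) sums (\<integral>\<omega>. F (X s \<omega>) \<partial>M)"
proof -
  let ?f = "\<lambda>k \<omega>. F (Y k \<omega>) * (indicator {..s} (\<tau> k \<omega>) - indicator {..s} (\<tau> (Suc k) \<omega>))"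
  note int = integrable_mult_time[OF integrable_F, where s=s]
  have f_eq: "?f k \<omega> = F (Y k \<omega>) * indicator {..s} (\<tau> k \<omega>) - F (Y k \<omega>) * indicator {..s} (\<tau> (Suc k) \<omega>)" for k \<omega>
    by (simp add: algebra_simps)
  have intf: "integrable M (?f k)" for k
    unfolding f_eq by (intro Bochner_Integration.integrable_diff int)
  have bound: "norm (\<integral>\<omega>. norm (?f k \<omega>) \<partial>M) \<le> total_norm_bound * (((3 * (C * s)) ^ k / fact k) + ((3 * (C * s)) ^ Suc k / fact (Suc k)))" for k
  proof -
    have mb: "0 \<le> total_norm_bound"
      unfolding total_norm_bound_def using pos by (intro add_nonneg_nonneg Bochner_Integration.integral_nonneg total_norm_nonneg) auto
    have "norm (\<integral>\<omega>. norm (?f k \<omega>) \<partial>M) = (\<integral>\<omega>. norm (?f k \<omega>) \<partial>M)"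
      by simp
    also have "\<dots> \<le> (\<integral>\<omega>. total_norm n (Y k \<omega>) * indicator {..s} (\<tau> k \<omega>) + total_norm n (Y k \<omega>) * indicator {..s} (\<tau> (Suc k) \<omega>) \<partial>M)"
      by (intro Bochner_Integration.integral_mono integrable_norm intf Bochner_Integration.integrable_add integrable_mult_time integrable_total_norm)
         (use F_le in \<open>auto simp: indicator_def total_norm_nonneg\<close>)
    also have "\<dots> = (\<integral>\<omega>. total_norm n (Y k \<omega>) * indicator {..s} (\<tau> k \<omega>) \<partial>M) + (\<integral>\<omega>. total_norm n (Y k \<omega>) * indicator {..s} (\<tau> (Suc k) \<omega>) \<partial>M)"
      by (intro Bochner_Integration.integral_add integrable_mult_time integrable_total_norm)
    also have "\<dots> \<le> 3 ^ k * total_norm_bound * ((C * s) ^ k / fact k) + 3 ^ k * total_norm_bound * ((C * s) ^ Suc k / fact (Suc k))"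
      by (intro add_mono expectation_total_norm_at_jump_time_le s)
    \<comment> \<open>The factor \<open>3 ^ k\<close> is enlarged to \<open>3 ^ Suc k\<close> so
      that the second term becomes the next term of the same series.\<close>
    also have "\<dots> \<le> 3 ^ k * total_norm_bound * ((C * s) ^ k / fact k) + 3 ^ Suc k * total_norm_bound * ((C * s) ^ Suc k / fact (Suc k))"
      using mb s pos by (intro add_left_mono mult_right_mono) auto
    also have "\<dots> = total_norm_bound * (((3 * (C * s)) ^ k / fact k) + ((3 * (C * s)) ^ Suc k / fact (Suc k)))"
      by (simp only: power_mult_distrib[of 3]) (simp add: algebra_simps)
    finally show ?thesis .
  qed
  have sm: "summable (\<lambda>k. (3 * (C * s)) ^ k / fact k)"
    using summable_exp[of "3 * (C * s)"] by (simp add: field_simps)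
  have summ: "summable (\<lambda>k. \<integral>\<omega>. norm (?f k \<omega>) \<partial>M)"
    by (rule summable_comparison_test'[OF _ bound])
       (intro summable_mult summable_add sm summable_Suc_iff[THEN iffD2])
  have ae: "AE \<omega> in M. summable (\<lambda>k. norm (?f k \<omega>))" "AE \<omega> in M. (\<Sum>k. ?f k \<omega>) = F (X s \<omega>)"
    using AE_X_sum[OF s, of F] by (auto elim!: eventually_mono dest: sums_unique)
  have meas: "(\<lambda>\<omega>. \<Sum>k. ?f k \<omega>) \<in> borel_measurable M" "(\<lambda>\<omega>. F (X s \<omega>)) \<in> borel_measurable M"
    by measurable
  show "integrable M (\<lambda>\<omega>. F (X s \<omega>))"
    using integrable_suminf[OF intf ae(1) summ] integrable_cong_AE[OF meas ae(2)] by simp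
  have "(\<lambda>k. integral\<^sup>L M (?f k)) sums (\<integral>\<omega>. (\<Sum>k. ?f k \<omega>) \<partial>M)"
    by (rule sums_integral[OF intf ae(1) summ])
  also have "(\<integral>\<omega>. (\<Sum>k. ?f k \<omega>) \<partial>M) = (\<integral>\<omega>. F (X s \<omega>) \<partial>M)"
    by (rule integral_cong_AE[OF meas ae(2)])
  finally show "(\<lambda>k. (\<integral>\<omega>. F (Y k \<omega>) * indicator {..s} (\<tau> k \<omega>) \<partial>M)
         - (\<integral>\<omega>. F (Y k \<omega>) * indicator {..s} (\<tau> (Suc k) \<omega>) \<partial>M)) sums (\<integral>\<omega>. F (X s \<omega>) \<partial>M)"
    unfolding f_eq by (simp add: int)
qed

text \<open>Dynkin's formula for a function whose generator \<open>g\<close> depends on the count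
  alone. The hypothesis is the generator equation divided by the total rate; the rate returns
  through the departures, since count \<open>m\<close> is left \<open>c m * \<sigma> m * s\<close>
  times on average.\<close>

lemma expectation_X:
  assumes g: "\<And>x. x \<in> Xset n \<Longrightarrow> \<K> F x = F x + g (card_psi n (fst x)) / c (card_psi n (fst x))"
    and s: "0 \<le> s"
  shows "(\<integral>\<omega>. F (X s \<omega>) \<partial>M) = (\<integral>\<omega>. F (Y 0 \<omega>) \<partial>M) + s * (\<Sum>m\<le>n. g m * \<sigma> m)"
proof -
  define u where "u k = (\<integral>\<omega>. F (Y k \<omega>) * indicator {..s} (\<tau> k \<omega>) \<partial>M)" for k
  define w where "w k = (\<integral>\<omega>. F (Y k \<omega>) * indicator {..s} (\<tau> (Suc k) \<omega>) \<partial>M)" for k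
  \<comment> \<open>The two quantities meet at jump \<open>Suc k\<close>: there the chain leaves
    state \<open>k\<close>, which accounts for \<open>w k\<close>, and enters state
    \<open>Suc k\<close>, which accounts for \<open>u (Suc k)\<close>.\<close>
  have step: "u (Suc k) = w k + (\<Sum>m\<le>n. g m / c m * W k m s)" for k
  proof -
    let ?G = "\<lambda>x :: 'N state. F x + g (card_psi n (fst x)) / c (card_psi n (fst x))"
    have intg: "integrable M (\<lambda>\<omega>. g (J k \<omega>) / c (J k \<omega>))" by (rule integrable_fun_J)
    have "u (Suc k) = (\<integral>\<omega>. ?G (Y k \<omega>) * indicator {..s} (\<tau> (Suc k) \<omega>) \<partial>M)"
      unfolding u_def
    proof (rule expectation_markov_at_jump_time[OF F _ integrable_F _ g s])
      have "(\<lambda>x :: 'N state. g (card_psi n (fst x)) / c (card_psi n (fst x))) \<in> borel_measurable (stateM n)"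
        by (rule measurable_compose[OF measurable_card_psi]) simp
      then show "?G \<in> borel_measurable (stateM n)" by measurable
      show "integrable M (\<lambda>\<omega>. ?G (Y k \<omega>))"
        using intg integrable_F by (simp add: J_def)
    qed
    also have "\<dots> = (\<integral>\<omega>. F (Y k \<omega>) * indicator {..s} (\<tau> (Suc k) \<omega>) + (g (J k \<omega>) / c (J k \<omega>)) * indicator {..s} (\<tau> (Suc k) \<omega>) \<partial>M)"
      by (simp add: J_def distrib_right)
    also have "\<dots> = w k + (\<integral>\<omega>. (g (J k \<omega>) / c (J k \<omega>)) * indicator {..s} (\<tau> (Suc k) \<omega>) \<partial>M)"
      unfolding w_def by (intro Bochner_Integration.integral_add integrable_mult_time integrable_F intg)
    also have "(\<integral>\<omega>. (g (J k \<omega>) / c (J k \<omega>)) * indicator {..s} (\<tau> (Suc k) \<omega>) \<partial>M) = (\<Sum>m\<le>n. g m / c m * W k m s)"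
      by (rule expectation_fun_J)
    finally show ?thesis .
  qed
  have partial: "(\<Sum>k<K. u k - w k) = u 0 - u K + (\<Sum>m\<le>n. g m / c m * (\<Sum>k<K. W k m s))" for K
  proof -
    have "(\<Sum>k<K. u k - w k) = u 0 - u K + (\<Sum>k<K. \<Sum>m\<le>n. g m / c m * W k m s)"
      by (induction K) (simp_all add: step)
    also have "(\<Sum>k<K. \<Sum>m\<le>n. g m / c m * W k m s) = (\<Sum>m\<le>n. g m / c m * (\<Sum>k<K. W k m s))"
      unfolding sum_distrib_left by (rule sum.swap)
    finally show ?thesis .
  qed
  have "(\<lambda>K. u 0 - u K + (\<Sum>m\<le>n. g m / c m * (\<Sum>k<K. W k m s))) \<longlonglongrightarrow> u 0 - 0 + (\<Sum>m\<le>n. g m / c m * (c m * \<sigma> m * s))"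
    using expectation_F_at_jump_time_tendsto_0[OF s] s
    by (intro tendsto_intros W_limit) (auto simp: u_def)
  moreover have "(\<lambda>K. \<Sum>k<K. u k - w k) \<longlonglongrightarrow> (\<integral>\<omega>. F (X s \<omega>) \<partial>M)"
    using expectation_X_series[OF s] by (simp add: sums_def u_def w_def)
  ultimately have "(\<integral>\<omega>. F (X s \<omega>) \<partial>M) = u 0 + (\<Sum>m\<le>n. g m / c m * (c m * \<sigma> m * s))"
    unfolding partial using LIMSEQ_unique by fastforce
  also have "u 0 = (\<integral>\<omega>. F (Y 0 \<omega>) \<partial>M)"
    using s by (simp add: u_def jump_time_def)
  also have "(\<Sum>m\<le>n. g m / c m * (c m * \<sigma> m * s)) = s * (\<Sum>m\<le>n. g m * \<sigma> m)"
    unfolding sum_distrib_left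
  proof (intro sum.cong refl)
    fix m assume "m \<in> {..n}"
    then have "c m \<noteq> 0" using c_pos[of m] by simp
    then show "g m / c m * (c m * \<sigma> m * s) = s * (g m * \<sigma> m)" by simp
  qed
  finally show ?thesis .
qed

end

section \<open>The mean of the centroid\<close>

lemma centroid_component:
  fixes b :: 'N
  shows "(\<lambda>x. snd x n $ b) \<in> borel_measurable (stateM n :: 'N state measure)"
    and "\<bar>snd x n $ b\<bar> \<le> total_norm n (x :: 'N state)"
proof -
  have [measurable]: "(\<lambda>x. snd x n) \<in> borel_measurable (stateM n :: 'N state measure)"
    by (rule measurable_location_stateM) simp
  show "(\<lambda>x. snd x n $ b) \<in> borel_measurable (stateM n :: 'N state measure)"
    by (rule measurable_compose[OF _ borel_measurable_continuous_onI]) (auto intro!: continuous_intros)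
  show "\<bar>snd x n $ b\<bar> \<le> total_norm n x"
    using component_le_norm_cart[of "snd x n" b] norm_le_total_norm[of n n x] by simp
qed

text \<open>Integrability of the vector itself is what allows components to be taken under the
  integral; it follows from that of the finitely many components.\<close>

lemma integrable_centroid:
  assumes s: "0 \<le> s"
  shows "integrable M (\<lambda>\<omega>. snd (X s \<omega>) n)"
proof (rule Bochner_Integration.integrable_bound)
  show "integrable M (\<lambda>\<omega>. \<Sum>b\<in>UNIV. \<bar>snd (X s \<omega>) n $ b\<bar>)"
    by (intro Bochner_Integration.integrable_sum integrable_abs integrable_X[OF centroid_component s])
  show "(\<lambda>\<omega>. snd (X s \<omega>) n) \<in> borel_measurable M"
    by (rule measurable_compose[OF measurable_X measurable_location_stateM]) simp
  show "AE \<omega> in M. norm (snd (X s \<omega>) n) \<le> norm (\<Sum>b\<in>UNIV. \<bar>snd (X s \<omega>) n $ b\<bar>)"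
    by (intro AE_I2) (use norm_le_l1_cart in \<open>auto intro: order_trans\<close>)
qed

lemma expectation_centroid:
  assumes s: "0 \<le> s"
  shows "(\<integral>\<omega>. snd (X s \<omega>) n \<partial>M) = (\<chi> b. \<integral>\<omega>. snd (Y 0 \<omega>) n $ b \<partial>M)
     + s *\<^sub>R ((\<theta>d / (\<theta>d + \<theta>a) ^ n * ((\<theta>d + \<theta>a) ^ n - \<theta>d ^ n)) *\<^sub>R (\<integral>y. y \<partial>\<eta>))"
proof (subst vec_eq_iff, intro allI)
  fix b
  let ?e = "\<integral>y. y $ b \<partial>\<eta>"
  let ?g = "\<lambda>m. \<theta>a * (real n - real m) / (real m + 1) * ?e"
  have e: "(\<integral>y. y \<partial>\<eta>) $ b = ?e"
    by (rule integral_bounded_linear[OF bounded_linear_vec_nth integrable_\<eta>, symmetric])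
  have "(\<integral>\<omega>. snd (X s \<omega>) n \<partial>M) $ b = (\<integral>\<omega>. snd (X s \<omega>) n $ b \<partial>M)"
    by (rule integral_bounded_linear[OF bounded_linear_vec_nth integrable_centroid[OF s], symmetric])
  also have "\<dots> = (\<integral>\<omega>. snd (Y 0 \<omega>) n $ b \<partial>M) + s * (\<Sum>m\<le>n. ?g m * \<sigma> m)"
  proof (rule expectation_X[OF centroid_component _ s])
    fix x :: "'N state" assume "x \<in> Xset n"
    from sum_r_i_centroid[OF pos(1,2,3) prob_\<eta> integrable_\<eta>_nth this]
    show "\<K> (\<lambda>x. snd x n $ b) x = snd x n $ b + ?g (card_psi n (fst x)) / c (card_psi n (fst x))"
      by (simp add: kernel_mean_def)
  qed
  also have "(\<Sum>m\<le>n. ?g m * \<sigma> m) = (\<Sum>m\<le>n. \<theta>a * (real n - real m) / (real m + 1) * \<sigma> m) * ?e"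
    unfolding sum_distrib_right by (intro sum.cong refl) (simp only: mult_ac)
  also have "\<dots> = \<theta>d / (\<theta>d + \<theta>a) ^ n * ((\<theta>d + \<theta>a) ^ n - \<theta>d ^ n) * ?e"
    by (simp only: sum_drift_sigma_w[OF pos(1,2)])
  finally show "(\<integral>\<omega>. snd (X s \<omega>) n \<partial>M) $ b = ((\<chi> b. \<integral>\<omega>. snd (Y 0 \<omega>) n $ b \<partial>M)
     + s *\<^sub>R ((\<theta>d / (\<theta>d + \<theta>a) ^ n * ((\<theta>d + \<theta>a) ^ n - \<theta>d ^ n)) *\<^sub>R (\<integral>y. y \<partial>\<eta>))) $ b"
    by (simp add: e)
qed

lemma expectation_centroid_deriv:
  assumes "0 < t"
  shows "((\<lambda>s. \<integral>\<omega>. snd (X s \<omega>) n \<partial>M) has_vector_derivative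
      ((\<theta>d / (\<theta>d + \<theta>a) ^ n * ((\<theta>d + \<theta>a) ^ n - \<theta>d ^ n)) *\<^sub>R (\<integral>y. y \<partial>\<eta>))) (at t)"
\<comment> \<open>The affine formula is known for nonnegative times only, so it is used on the open
  half-line, which contains \<open>t\<close>.\<close>
proof (rule has_vector_derivative_transform_within_open[where S="{0<..}"])
  have "((\<lambda>s. a + s *\<^sub>R d) has_vector_derivative d) (at t)" for a d :: "real^'N"
    by (auto intro!: derivative_eq_intros)
  then show "((\<lambda>s. (\<chi> b. \<integral>\<omega>. snd (Y 0 \<omega>) n $ b \<partial>M) + s *\<^sub>R
        ((\<theta>d / (\<theta>d + \<theta>a) ^ n * ((\<theta>d + \<theta>a) ^ n - \<theta>d ^ n)) *\<^sub>R (\<integral>y. y \<partial>\<eta>)))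
      has_vector_derivative
        ((\<theta>d / (\<theta>d + \<theta>a) ^ n * ((\<theta>d + \<theta>a) ^ n - \<theta>d ^ n)) *\<^sub>R (\<integral>y. y \<partial>\<eta>))) (at t)" .
qed (use assms in \<open>auto simp: expectation_centroid\<close>)

end

theorem theorem2:
  fixes \<theta>a \<theta>d R t :: real and n :: nat
    and \<eta> :: "(real^'N::finite) measure" and \<rho> :: "'N state measure"
    and M :: "'w measure" and Y :: "nat \<Rightarrow> 'w \<Rightarrow> 'N state" and \<gamma> :: "nat \<Rightarrow> 'w \<Rightarrow> real"
  assumes "\<theta>a > 0" and "\<theta>d > 0" and "n > 0" and "R > 0"
    and "prob_space \<eta>" and "sets \<eta> = sets borel"
    and "AE x in \<eta>. \<forall>i. \<bar>x $ i\<bar> \<le> R"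
    and "prob_space \<rho>" and "sets \<rho> = sets (stateM n)"
    and "distr \<rho> (count_space UNIV) (\<lambda>x. card_psi n (fst x))
           = density (count_space UNIV) (\<lambda>k. ennreal (sigma_w \<theta>a \<theta>d n k))"
    and "\<forall>i\<le>n. integrable \<rho> (\<lambda>x. snd x i)"
    and "prob_space M"
    and "\<forall>k. Y k \<in> measurable M (stateM n)"
    and "distr M (stateM n) (Y 0) = \<rho>"
    and "\<forall>k B. (\<forall>j. B j \<in> sets (stateM n)) \<longrightarrow>
           measure M {\<omega> \<in> space M. \<forall>j\<le>Suc k. Y j \<omega> \<in> B j}
           = (\<integral>\<omega>. indicator {\<omega> \<in> space M. \<forall>j\<le>k. Y j \<omega> \<in> B j} \<omega>
                    * jump_kernel \<theta>a \<theta>d \<eta> n (Y k \<omega>) (B (Suc k)) \<partial>M)"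
    and "\<forall>k\<ge>1. distributed M lborel (\<gamma> k) (exponential_density 1)"
    and "prob_space.indep_vars M (\<lambda>_. borel) \<gamma> {1..}"
    and "prob_space.indep_set M
           {(\<lambda>\<omega> k. Y k \<omega>) -` A \<inter> space M | A. A \<in> sets (PiM UNIV (\<lambda>_. stateM n))}
           {(\<lambda>\<omega>. restrict (\<lambda>k. \<gamma> k \<omega>) {1..}) -` A \<inter> space M | A.
               A \<in> sets (PiM {1..} (\<lambda>_. (borel :: real measure)))}"
    and "t > 0"
  shows "((\<lambda>s. \<integral>\<omega>. snd (Xproc (rate_fun \<theta>a \<theta>d n) Y \<gamma> s \<omega>) n \<partial>M)
          has_vector_derivative
            ((\<theta>d / (\<theta>d + \<theta>a) ^ n * ((\<theta>d + \<theta>a) ^ n - \<theta>d ^ n)) *\<^sub>R (\<integral>x. x \<partial>\<eta>))) (at t)"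
proof -
  interpret prob_space M by fact
  interpret attachment_process M \<theta>a \<theta>d R n \<eta> \<rho> Y \<gamma>
    by (intro attachment_process.intro attachment_process_axioms.intro assms)
  show ?thesis by (rule expectation_centroid_deriv) fact
qed

end
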